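(* Let $\rho>0$ and let $\mathscr{D}[\rho]\subset\mathbb{R}^{n}$ be the spectratope at uncertainty level $\rho$ defined in the context by the data $P\in\mathbb{R}^{n\times\bar n}$, $S^{ki}\in\mathbb{S}^{f_k}$ ($k\le K$, $i\le\bar n$), $\mathcal{T}\subset\mathbb{R}^K_+$. For $s>0$ consider the semi-infinite constraint in variables $X\in\mathbb{S}^n$, $x\in\mathbb{R}^n$, $\xi\in\mathbb{R}$: $$(C[s]):\qquad \zeta^{\mathrm T}X\zeta+2x^{\mathrm T}\zeta\le\xi\quad\text{for all }\zeta\in\mathscr{D}[s],$$ and the system of convex constraints in variables $X,x,\xi$, $\Lambda=\{\Lambda_k\in\mathbb{S}^{f_k},k\le K\}$, $\tau\in\mathbb{R}$: $$(\mathbf{S}[\rho]):\qquad \Lambda_k\in\mathbb{S}^{f_k}_+,\ k\le K,\qquad \begin{bmatrix}\sum_k\mathcal{S}_k^*[\Lambda_k]-P^{\mathrm T}XP&-P^{\mathrm T}x\\-x^{\mathrm T}P&\tau\end{bmatrix}\succeq0,\qquad \rho\,\phi_{\mathcal{T}}(\lambda[\Lambda])+\tau\le\xi,$$ where $\lambda[\Lambda]=[\mathrm{Tr}(\Lambda_1);\dots;\mathrm{Tr}(\Lambda_K)]$, $\phi_{\mathcal{T}}(\lambda)=\max_{t\in\mathcal{T}}\lambda^{\mathrm T}t$ and $\mathcal{S}_k^*:\mathbb{S}^{f_k}\to\mathbb{S}^{\bar n}$ is given by $[\mathcal{S}_k^*[D]]_{ij}=\mathrm{Tr}(DS^{ki}S^{kj})$.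 Then: (i) $(\mathbf{S}[\rho])$ is a safe approximation of $(C[\rho])$: whenever $(X,x,\xi)$ can be augmented by some $\Lambda,\tau$ to a feasible solution of $(\mathbf{S}[\rho])$, $(X,x,\xi)$ is feasible for $(C[\rho])$. (ii) This approximation is tight within the factor $\varkappa=2\ln\left(8\sum_{k=1}^Kf_k\right)$: whenever $(X,x,\xi)$ cannot be augmented by $\Lambda,\tau$ to a feasible solution of $(\mathbf{S}[\rho])$, $(X,x,\xi)$ is not feasible for $(C[\varkappa\rho])$.
   Context: $\mathbb{S}^m$ is the space of real symmetric $m\times m$ matrices, $\mathbb{S}^m_+$ the cone of positive semidefinite ones; $A\succeq B$ means $A-B\in\mathbb{S}^m_+$. $I_m$ is the $m\times m$ identity matrix. Spectratopes: let $K\ge1$, let $P$ be a real $n\times\bar n$ matrix, and for $k\le K$ let $S_k[z]=\sum_{i=1}^{\bar n}z_iS^{ki}$ with $S^{ki}\in\mathbb{S}^{f_k}$, so that $S_k[\cdot]:\mathbb{R}^{\bar n}\to\mathbb{S}^{f_k}$ is linear; $S_k^2[z]$ denotes $(S_k[z])^2$. Let $\mathcal{T}\subset\mathbb{R}^K_+$ be a nonempty convex compact set which intersects the interior of $\mathbb{R}^K_+$ and is monotone: if $0\le t\le t'$ (entrywise) and $t'\in\mathcal{T}$, then $t\in\mathcal{T}$. For $\rho>0$, $$\mathscr{D}[\rho]=\{\zeta\in\mathbb{R}^n:\ \exists t\in\mathcal{T},\,z\in\mathbb{R}^{\bar n}:\ \zeta=Pz,\ S_k^2[z]\preceq\rho\,t_kI_{f_k},\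 k\le K\}.$$ *)

theory Defs
  imports "HOL-Analysis.Analysis" "Jordan_Normal_Form.Matrix"
begin

(* "$" and the bullet below are those of Jordan_Normal_Form. The theory-qualified Matrix.mat
   avoids the constant "mat" of HOL-Analysis. *)
unbundle no vec_syntax and no inner_syntax

definition sym_mats :: "nat \<Rightarrow> real mat set" where
  "sym_mats m = {A \<in> carrier_mat m m. transpose_mat A = A}"

definition psd_mats :: "nat \<Rightarrow> real mat set" where
  "psd_mats m = {A \<in> sym_mats m. \<forall>v \<in> carrier_vec m. 0 \<le> v \<bullet> (A *\<^sub>v v)}"

definition loewner_le :: "nat \<Rightarrow> real mat \<Rightarrow> real mat \<Rightarrow> bool" where
  "loewner_le m A B \<longleftrightarrow> A \<in> sym_mats m \<and> B \<in> sym_mats m \<and> B - A \<in> psd_mats m"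

definition mat_trace :: "real mat \<Rightarrow> real" where
  "mat_trace A = (\<Sum>i<dim_row A. A $$ (i, i))"

(* The zero matrix has no canonical dimensions, so the big operator for sums is not available
   on type mat. *)
definition mat_sum :: "nat \<Rightarrow> 'i set \<Rightarrow> ('i \<Rightarrow> real mat) \<Rightarrow> real mat" where
  "mat_sum m I A = Matrix.mat m m (\<lambda>(a, b). \<Sum>i\<in>I. A i $$ (a, b))"

(* The paper's S_k[z], with Sk i standing for S^{ki} (of size m = f_k). Indices i run over
   {0..<nb}, where nb is the dimension of the vectors z; the values of Sk elsewhere are
   irrelevant. *)
definition lin_mat :: "nat \<Rightarrow> nat \<Rightarrow> (nat \<Rightarrow> real mat) \<Rightarrow> real vec \<Rightarrow> real mat" where
  "lin_mat nb m Sk z = mat_sum m {..<nb} (\<lambda>i. z $ i \<cdot>\<^sub>m Sk i)"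

(* The map written with a calligraphic S_k^*: [S_k^*[D]]_{ij} = Tr(D S^{ki} S^{kj}). *)
definition quad_adj :: "nat \<Rightarrow> (nat \<Rightarrow> real mat) \<Rightarrow> real mat \<Rightarrow> real mat" where
  "quad_adj nb Sk D = Matrix.mat nb nb (\<lambda>(i, j). mat_trace (D * Sk i * Sk j))"

(* phi_T(l) = max_{t in T} l^T t; the supremum is attained for nonempty compact T. *)
definition support_fun :: "(real ^ 'k::finite) set \<Rightarrow> real ^ 'k \<Rightarrow> real" where
  "support_fun T l = (SUP t\<in>T. inner l t)"

(* The index k <= K is an element of the finite type 'k, so K = CARD('k) >= 1. *)
definition spectratope ::
  "nat \<Rightarrow> ('k::finite \<Rightarrow> nat) \<Rightarrow> real mat \<Rightarrow> ('k \<Rightarrow> nat \<Rightarrow> real mat) \<Rightarrow> (real ^ 'k) set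
     \<Rightarrow> real \<Rightarrow> real vec set" where
  "spectratope nb f P S T \<rho> =
     {P *\<^sub>v z | t z. t \<in> T \<and> z \<in> carrier_vec nb \<and>
        (\<forall>k. loewner_le (f k) (lin_mat nb (f k) (S k) z ^\<^sub>m 2)
                (\<rho> * vec_nth t k \<cdot>\<^sub>m 1\<^sub>m (f k)))}"

definition semi_inf_feasible ::
  "real vec set \<Rightarrow> real mat \<Rightarrow> real vec \<Rightarrow> real \<Rightarrow> bool" where
  "semi_inf_feasible D X x \<xi> \<longleftrightarrow> (\<forall>\<zeta>\<in>D. \<zeta> \<bullet> (X *\<^sub>v \<zeta>) + 2 * (x \<bullet> \<zeta>) \<le> \<xi>)"

definition approx_feasible ::
  "nat \<Rightarrow> nat \<Rightarrow> ('k::finite \<Rightarrow> nat) \<Rightarrow> real mat \<Rightarrow> ('k \<Rightarrow> nat \<Rightarrow> real mat) \<Rightarrow> (real ^ 'k) set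
     \<Rightarrow> real \<Rightarrow> real mat \<Rightarrow> real vec \<Rightarrow> real \<Rightarrow> ('k \<Rightarrow> real mat) \<Rightarrow> real \<Rightarrow> bool" where
  "approx_feasible n nb f P S T \<rho> X x \<xi> L \<tau> \<longleftrightarrow>
     (\<forall>k. L k \<in> psd_mats (f k)) \<and>
     four_block_mat
       (mat_sum nb UNIV (\<lambda>k. quad_adj nb (S k) (L k)) - transpose_mat P * X * P)
       (- (transpose_mat P * mat_of_cols n [x]))
       (- (mat_of_rows n [x] * P))
       (Matrix.mat 1 1 (\<lambda>_. \<tau>)) \<in> psd_mats (nb + 1) \<and>
     \<rho> * support_fun T (vec_lambda (\<lambda>k. mat_trace (L k))) + \<tau> \<le> \<xi>"

end

theory Submission
  imports Defs "Jordan_Normal_Form.Determinant"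
begin

text \<open>
Let \<open>q z\<close> be the objective at \<open>\<zeta> = P z\<close>, a quadratic polynomial in \<open>z\<close>. The semidefinite system at level
\<open>\<rho>\<close> is the Lagrangian dual of a relaxation of the semi-infinite constraint, in which the point \<open>z\<close> is
replaced by a probability distribution of points that satisfies \<open>E (S\<^sub>k[z]\<^sup>2) \<le> \<rho> t\<^sub>k I\<close> only on average.
Safety is therefore weak duality (\<open>approximation_is_safe\<close>).

Tightness combines two facts. First, if the relaxation has value at most \<open>\<xi>\<close>, then multipliers certifying
this exist (\<open>lagrange_multipliers_exist\<close>). The strictly positive point of \<open>T\<close> is a Slater point and
confines the multipliers to a compact set, on which a minimax argument applies
(\<open>convex_affine_system_solvable\<close>).

Second, the gap between the relaxation and the semi-infinite constraint is closed by rounding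
(\<open>randomized_rounding\<close>). A distribution with mean objective above \<open>\<xi>\<close> is recombined orthogonally into
vectors \<open>(y\<^sub>i, s\<^sub>i)\<close> that diagonalise the homogenised objective. The signed sums \<open>(Y, s) = \<Sum>i. \<epsilon>\<^sub>i (y\<^sub>i, s\<^sub>i)\<close>
then all have the same value, above \<open>\<xi>\<close>, whatever the signs. For random signs \<open>S\<^sub>k[Y] = \<Sum>i. \<epsilon>\<^sub>i S\<^sub>k[y\<^sub>i]\<close>
is a matrix Rademacher series with \<open>\<Sum>i. S\<^sub>k[y\<^sub>i]\<^sup>2 \<le> \<rho> t\<^sub>k I\<close>, so by the noncommutative Khintchine tail bound
(\<open>matrix_khintchine_tail\<close>) the constraint \<open>S\<^sub>k[Y]\<^sup>2 \<le> \<kappa> \<rho> t\<^sub>k I\<close> fails with probability at most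
\<open>2 f\<^sub>k exp (- \<kappa> / 2)\<close>. For \<open>\<kappa> = 2 ln (8 \<Sum>k. f\<^sub>k)\<close> these probabilities add up to at most \<open>1 / 4\<close>. As
\<open>\<Sum>i. s\<^sub>i\<^sup>2 \<le> 1\<close>, the event \<open>\<bar>s\<bar> \<le> 1\<close> has probability at least \<open>1 / 3\<close> (\<open>signed_sum_anticoncentration\<close>), so
it meets the complement of all failures, and there \<open>Y\<close> or \<open>- Y\<close> violates the semi-infinite constraint
at the level \<open>\<kappa> \<rho>\<close>.

The tail bound is proved by the method of exchangeable pairs: flipping one sign and a trace inequality
for pairs of symmetric matrices (\<open>mean_value_trace_inequality\<close>) give a differential inequality for
\<open>E Tr cosh (\<theta>X)\<close>.
\<close>

section \<open>The spectral theorem for real symmetric matrices\<close>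

text \<open>
The dimensions \<open>f k\<close> and \<open>nb\<close> are numbers, so vectors and matrices are represented by functions on
\<open>nat\<close> of which only the values below the dimension matter. In this form they carry the product
topology, which gives the compactness arguments below without any carrier sets.
\<close>

definition dot :: "nat \<Rightarrow> (nat \<Rightarrow> real) \<Rightarrow> (nat \<Rightarrow> real) \<Rightarrow> real" where
  "dot m x y = (\<Sum>i<m. x i * y i)"

definition mv :: "nat \<Rightarrow> (nat \<Rightarrow> nat \<Rightarrow> real) \<Rightarrow> (nat \<Rightarrow> real) \<Rightarrow> nat \<Rightarrow> real" where
  "mv m A x = (\<lambda>i. \<Sum>j<m. A i j * x j)"

definition symm :: "nat \<Rightarrow> (nat \<Rightarrow> nat \<Rightarrow> real) \<Rightarrow> bool" where
  "symm m A \<longleftrightarrow> (\<forall>i<m. \<forall>j<m. A i j = A j i)"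

definition orthonormal :: "nat \<Rightarrow> (nat \<Rightarrow> nat \<Rightarrow> real) \<Rightarrow> bool" where
  "orthonormal m u \<longleftrightarrow> (\<forall>a<m. \<forall>b<m. dot m (u a) (u b) = (if a = b then 1 else 0))"

definition eigenbasis ::
  "nat \<Rightarrow> (nat \<Rightarrow> nat \<Rightarrow> real) \<Rightarrow> (nat \<Rightarrow> real) \<Rightarrow> (nat \<Rightarrow> nat \<Rightarrow> real) \<Rightarrow> bool" where
  "eigenbasis m A lam u \<longleftrightarrow>
     orthonormal m u \<and> (\<forall>a<m. \<forall>i<m. mv m A (u a) i = lam a * u a i)"

lemma dot_commute: "dot m x y = dot m y x"
  by (simp add: dot_def mult.commute)

lemma dot_cong: "(\<And>i. i < m \<Longrightarrow> x i = x' i) \<Longrightarrow> (\<And>i. i < m \<Longrightarrow> y i = y' i) \<Longrightarrow> dot m x y = dot m x' y'"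
  by (simp add: dot_def)

lemma dot_self_nonneg: "0 \<le> dot m x x"
  by (simp add: dot_def sum_nonneg)

lemma dot_lin_right: "dot m x (\<lambda>i. \<Sum>j\<in>J. c j * y j i) = (\<Sum>j\<in>J. c j * dot m x (y j))"
  unfolding dot_def sum_distrib_left sum_distrib_right
  by (subst sum.swap) (simp add: mult_ac)

lemma dot_lin_left: "dot m (\<lambda>i. \<Sum>j\<in>J. c j * y j i) x = (\<Sum>j\<in>J. c j * dot m (y j) x)"
  using dot_lin_right[of m x c y J] by (simp add: dot_commute)

lemma dot_comb2:
  "dot m x (\<lambda>i. a * y i + b * z i) = a * dot m x y + b * dot m x z"
  "dot m (\<lambda>i. a * y i + b * z i) x = a * dot m y x + b * dot m z x"
  by (simp_all add: dot_def algebra_simps sum.distrib sum_distrib_left)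

lemma dot_unit:
  assumes "i < m" shows "dot m (\<lambda>j. if j = i then 1 else 0) y = y i"
proof -
  have "dot m (\<lambda>j. if j = i then 1 else 0) y = (\<Sum>j<m. if j = i then y j else 0)"
    unfolding dot_def by (intro sum.cong) auto
  thus ?thesis using assms by simp
qed

lemma dot_unit_right: "i < m \<Longrightarrow> dot m y (\<lambda>j. if j = i then 1 else 0) = y i"
  by (subst dot_commute) (rule dot_unit)

lemma mv_lin: "mv m A (\<lambda>i. \<Sum>j\<in>J. c j * y j i) = (\<lambda>i. \<Sum>j\<in>J. c j * mv m A (y j) i)"
  unfolding mv_def sum_distrib_left
  by (rule ext, subst sum.swap) (simp add: mult_ac)

lemma mv_comb2: "mv m A (\<lambda>i. a * y i + b * z i) = (\<lambda>i. a * mv m A y i + b * mv m A z i)"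
  unfolding mv_def by (rule ext) (simp add: algebra_simps sum.distrib sum_distrib_left)

lemma mv_self_adjoint:
  assumes "symm m A" shows "dot m x (mv m A y) = dot m (mv m A x) y"
proof -
  have "dot m x (mv m A y) = (\<Sum>i<m. \<Sum>j<m. A i j * x i * y j)"
    by (simp add: dot_def mv_def sum_distrib_left mult_ac)
  also have "\<dots> = (\<Sum>j<m. \<Sum>i<m. A j i * x i * y j)"
    using assms by (subst sum.swap) (auto simp: symm_def intro!: sum.cong)
  also have "\<dots> = dot m (mv m A x) y"
    by (simp add: dot_def mv_def sum_distrib_right)
  finally show ?thesis .
qed

text \<open>
Orthonormality of the rows says \<open>U * U\<^sup>T = 1\<close>; for a square matrix this implies \<open>U\<^sup>T * U = 1\<close>, which
is orthonormality of the columns.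
\<close>

lemma orthonormal_complete:
  assumes "orthonormal m u" "i < m" "j < m"
  shows "(\<Sum>a<m. u a i * u a j) = (if i = j then 1 else 0)"
proof -
  let ?U = "Matrix.mat m m (\<lambda>(a, i). u a i)"
  have U: "?U \<in> carrier_mat m m" by simp
  have "?U * transpose_mat ?U = 1\<^sub>m m"
    using assms(1) by (intro eq_matI)
      (auto simp: orthonormal_def dot_def scalar_prod_def atLeast0LessThan)
  hence "transpose_mat ?U * ?U = 1\<^sub>m m"
    by (intro mat_mult_left_right_inverse[OF U]) auto
  hence "(transpose_mat ?U * ?U) $$ (i, j) = 1\<^sub>m m $$ (i, j)" by simp
  thus ?thesis using assms(2,3) by (simp add: scalar_prod_def atLeast0LessThan)
qed

lemma parseval:
  assumes "orthonormal m u"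
  shows "dot m x y = (\<Sum>a<m. dot m (u a) x * dot m (u a) y)"
proof -
  have "(\<Sum>a<m. dot m (u a) x * dot m (u a) y)
      = (\<Sum>a<m. \<Sum>i<m. \<Sum>j<m. (x i * y j) * (u a i * u a j))"
    by (simp add: dot_def sum_product mult_ac)
  also have "\<dots> = (\<Sum>i<m. \<Sum>a<m. \<Sum>j<m. (x i * y j) * (u a i * u a j))"
    by (rule sum.swap)
  also have "\<dots> = (\<Sum>i<m. \<Sum>j<m. \<Sum>a<m. (x i * y j) * (u a i * u a j))"
    by (intro sum.cong refl sum.swap)
  also have "\<dots> = (\<Sum>i<m. \<Sum>j<m. (x i * y j) * (if i = j then 1 else 0))"
    by (simp add: sum_distrib_left[symmetric] orthonormal_complete[OF assms])
  also have "\<dots> = dot m x y"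
    by (simp add: dot_def mult_delta_right)
  finally show ?thesis by simp
qed

lemma eigenbasis_dot_mv:
  assumes "symm m A" "eigenbasis m A lam u" "a < m"
  shows "dot m (u a) (mv m A x) = lam a * dot m (u a) x"
proof -
  have "dot m (mv m A (u a)) x = dot m (\<lambda>i. lam a * u a i) x"
    using assms by (intro dot_cong) (auto simp: eigenbasis_def)
  also have "\<dots> = lam a * dot m (u a) x" by (simp add: dot_def sum_distrib_left mult.assoc)
  finally show ?thesis by (simp only: mv_self_adjoint[OF assms(1)])
qed

lemma compact_fun_box:
  fixes K :: "'i \<Rightarrow> 'b::topological_space set"
  assumes "\<And>i. compact (K i)"
  shows "compact {x. \<forall>i. x i \<in> K i}"
proof -
  have "compactin (product_topology (\<lambda>i. euclidean) UNIV) (PiE UNIV K)"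
    using assms by (subst compactin_PiE) simp
  thus ?thesis by (simp add: euclidean_product_topology PiE_UNIV_domain Pi_def)
qed

lemma continuous_on_eval2 [continuous_intros]:
  fixes S :: "('a \<Rightarrow> 'b \<Rightarrow> 'c::topological_space) set"
  shows "continuous_on S (\<lambda>u. u a b)"
  by (rule continuous_on_product_then_coordinatewise[OF
        continuous_on_product_then_coordinatewise[OF continuous_on_id]])

text \<open>
The left-hand side is the value of \<open>p * <u\<^sub>p, A u\<^sub>p> + q * <u\<^sub>q, A u\<^sub>q>\<close> after the pair \<open>u\<^sub>p, u\<^sub>q\<close> has been
rotated by the angle \<open>\<phi>\<close>, with \<open>\<alpha>, \<beta>, \<gamma>\<close> the entries of the corresponding block of \<open>A\<close>. Its
derivative at \<open>\<phi> = 0\<close> is \<open>2 * (p - q) * \<beta>\<close>.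
\<close>

lemma rotation_first_order:
  fixes p q \<alpha> \<beta> \<gamma> :: real
  assumes "p \<noteq> q"
    and "\<And>\<phi>. p * ((cos \<phi>)\<^sup>2 * \<alpha> + 2 * cos \<phi> * sin \<phi> * \<beta> + (sin \<phi>)\<^sup>2 * \<gamma>)
        + q * ((sin \<phi>)\<^sup>2 * \<alpha> - 2 * cos \<phi> * sin \<phi> * \<beta> + (cos \<phi>)\<^sup>2 * \<gamma>) \<le> p * \<alpha> + q * \<gamma>"
  shows "\<beta> = 0"
proof -
  let ?h = "\<lambda>\<phi>. p * ((cos \<phi>)\<^sup>2 * \<alpha> + 2 * cos \<phi> * sin \<phi> * \<beta> + (sin \<phi>)\<^sup>2 * \<gamma>)
        + q * ((sin \<phi>)\<^sup>2 * \<alpha> - 2 * cos \<phi> * sin \<phi> * \<beta> + (cos \<phi>)\<^sup>2 * \<gamma>)"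
  have "DERIV ?h 0 :> 2 * (p - q) * \<beta>"
    by (rule derivative_eq_intros refl | simp add: left_diff_distrib)+
  moreover have "\<forall>y. \<bar>0 - y\<bar> < 1 \<longrightarrow> ?h y \<le> ?h 0" using assms(2) by simp
  ultimately have "2 * (p - q) * \<beta> = 0" by (intro DERIV_local_max[of ?h _ 0 1]) auto
  thus ?thesis using assms(1) by simp
qed

text \<open>
An eigenbasis is found as a maximiser, over the compact set of orthonormal frames, of
\<open>\<Sum>a. a * <u\<^sub>a, A u\<^sub>a>\<close>. The weights are distinct, so rotating two frame vectors into each other would
improve the value to first order unless \<open><u\<^sub>p, A u\<^sub>q> = 0\<close>. Hence \<open>A\<close> is diagonal in the maximising
frame.
\<close>

theorem spectral_theorem:
  assumes sym: "symm m A"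
  obtains lam u where "eigenbasis m A lam u"
proof -
  define F where "F = {u. orthonormal m u \<and> (\<forall>a i. \<not> (a < m \<and> i < m) \<longrightarrow> u a i = 0)}"
  define g where "g u = (\<Sum>a<m. real a * dot m (u a) (mv m A (u a)))" for u
  have "F \<subseteq> {u. \<forall>a. u a \<in> {v. \<forall>i. v i \<in> {-1..1}}}"
  proof safe
    fix u a i assume u: "u \<in> F"
    show "u a i \<in> {-1..1}"
    proof (cases "a < m \<and> i < m")
      case True
      have "(u a i)\<^sup>2 \<le> (\<Sum>i<m. (u a i)\<^sup>2)" using True by (intro member_le_sum) auto
      also have "\<dots> = 1" using u True by (auto simp: F_def orthonormal_def dot_def power2_eq_square)
      finally have "\<bar>u a i\<bar> \<le> 1" by (simp add: abs_square_le_1)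
      thus ?thesis by (auto simp: abs_le_iff)
    qed (use u in \<open>auto simp: F_def\<close>)
  qed
  moreover have "compact {u::nat\<Rightarrow>nat\<Rightarrow>real. \<forall>a. u a \<in> {v. \<forall>i. v i \<in> {-1..1}}}"
    by (intro compact_fun_box) simp
  moreover have "closed F"
  proof -
    have c1: "closed {u. dot m (u a) (u b) = (if a = b then 1 else 0)}" for a b
      unfolding dot_def by (intro closed_Collect_eq continuous_intros)
    have c2: "closed {u::nat\<Rightarrow>nat\<Rightarrow>real. u a i = 0}" for a i
      by (intro closed_Collect_eq continuous_intros)
    have "F = (\<Inter>a\<in>{..<m}. \<Inter>b\<in>{..<m}. {u. dot m (u a) (u b) = (if a = b then 1 else 0)}) \<inter>
       (\<Inter>(a, i)\<in>-({..<m}\<times>{..<m}). {u. u a i = 0})"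
      by (auto simp: F_def orthonormal_def)
    also have "closed \<dots>"
      by (intro closed_Int closed_INT ballI c1) (auto intro: c2)
    finally show ?thesis .
  qed
  ultimately have "compact F"
    using compact_Int_closed[of "{u. \<forall>a. u a \<in> {v. \<forall>i. v i \<in> {-1..1}}}" F]
    by (simp add: Int_absorb1)
  moreover have "(\<lambda>a i. if a < m \<and> i = a then 1 else 0) \<in> F"
    by (auto simp: F_def orthonormal_def dot_unit)
  hence "F \<noteq> {}" by blast
  moreover have "continuous_on F g"
    unfolding g_def dot_def mv_def by (intro continuous_intros)
  ultimately obtain u where u: "u \<in> F" and max: "\<And>v. v \<in> F \<Longrightarrow> g v \<le> g u"
    using continuous_attains_sup[of F g] by blast
  have on: "orthonormal m u" using u by (simp add: F_def)
  have off: "dot m (u p) (mv m A (u q)) = 0" if pq: "p < m" "q < m" "p \<noteq> q" for p q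
  proof (rule rotation_first_order)
    show "real p \<noteq> real q" using pq by simp
    fix \<phi> :: real
    define c s where "c = cos \<phi>" and "s = sin \<phi>"
    have cs: "c * c + s * s = 1"
      using sin_cos_squared_add[of \<phi>] by (simp add: c_def s_def power2_eq_square add.commute)
    \<comment> \<open>An opaque name for \<open>- s\<close> keeps the second rotated vector in the form of the bilinearity rules.\<close>
    define d where "d = - s"
    define v where "v = u(p := \<lambda>i. c * u p i + s * u q i, q := \<lambda>i. d * u p i + c * u q i)"
    have v: "v p = (\<lambda>i. c * u p i + s * u q i)" "v q = (\<lambda>i. d * u p i + c * u q i)"
      and v': "\<And>a. a \<noteq> p \<Longrightarrow> a \<noteq> q \<Longrightarrow> v a = u a"
      using pq by (auto simp: v_def)
    have o: "dot m (u a) (u b) = (if a = b then 1 else 0)" if "a < m" "b < m" for a b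
      using on that by (simp add: orthonormal_def)
    have "dot m (v a) (v b) = (if a = b then 1 else 0)" if "a < m" "b < m" for a b
    proof -
      have "a = p \<or> a = q \<or> a \<noteq> p \<and> a \<noteq> q" "b = p \<or> b = q \<or> b \<noteq> p \<and> b \<noteq> q"
        by blast+
      moreover have "c * d + s * c = 0" "d * c + c * s = 0" "d * d + c * c = 1"
        using cs by (simp_all add: d_def)
      ultimately show ?thesis
        using cs pq that by (elim disjE) (simp_all add: v v' dot_comb2 o)
    qed
    hence "orthonormal m v" by (simp add: orthonormal_def)
    moreover have "v a i = 0" if "\<not> (a < m \<and> i < m)" for a i
      using u pq that by (auto simp: F_def v_def)
    ultimately have "v \<in> F" by (simp add: F_def)
    hence le: "g v \<le> g u" by (rule max)
    have qp: "dot m (u q) (mv m A (u p)) = dot m (u p) (mv m A (u q))"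
      using mv_self_adjoint[OF sym] by (simp add: dot_commute)
    have split: "(\<Sum>a<m. h a) = h p + h q + (\<Sum>a\<in>{..<m}-{p,q}. h a)" for h :: "nat \<Rightarrow> real"
      using pq by (subst sum.subset_diff[of "{p,q}"]) auto
    have rest: "(\<Sum>a\<in>{..<m}-{p,q}. real a * dot m (v a) (mv m A (v a)))
              = (\<Sum>a\<in>{..<m}-{p,q}. real a * dot m (u a) (mv m A (u a)))"
      by (intro sum.cong) (auto simp: v')
    have vp: "dot m (v p) (mv m A (v p)) = c\<^sup>2 * dot m (u p) (mv m A (u p))
       + 2 * c * s * dot m (u p) (mv m A (u q)) + s\<^sup>2 * dot m (u q) (mv m A (u q))"
      by (simp only: v mv_comb2 dot_comb2 qp) (simp add: power2_eq_square algebra_simps)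
    have vq: "dot m (v q) (mv m A (v q)) = s\<^sup>2 * dot m (u p) (mv m A (u p))
       - 2 * c * s * dot m (u p) (mv m A (u q)) + c\<^sup>2 * dot m (u q) (mv m A (u q))"
      by (simp only: v mv_comb2 dot_comb2 qp) (simp add: d_def power2_eq_square algebra_simps)
    show "real p * ((cos \<phi>)\<^sup>2 * dot m (u p) (mv m A (u p)) +
         2 * cos \<phi> * sin \<phi> * dot m (u p) (mv m A (u q)) +
         (sin \<phi>)\<^sup>2 * dot m (u q) (mv m A (u q))) +
        real q * ((sin \<phi>)\<^sup>2 * dot m (u p) (mv m A (u p)) -
         2 * cos \<phi> * sin \<phi> * dot m (u p) (mv m A (u q)) +
         (cos \<phi>)\<^sup>2 * dot m (u q) (mv m A (u q)))
        \<le> real p * dot m (u p) (mv m A (u p)) + real q * dot m (u q) (mv m A (u q))"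
      using le vp vq split[of "\<lambda>a. real a * dot m (v a) (mv m A (v a))"] rest
        split[of "\<lambda>a. real a * dot m (u a) (mv m A (u a))"]
      unfolding g_def c_def[symmetric] s_def[symmetric] by simp
  qed
  have "mv m A (u a) i = dot m (u a) (mv m A (u a)) * u a i" if "a < m" "i < m" for a i
  proof -
    have "mv m A (u a) i = dot m (\<lambda>j. if j = i then 1 else 0) (mv m A (u a))"
      using that by (simp add: dot_unit)
    also have "\<dots> = (\<Sum>b<m. dot m (u b) (\<lambda>j. if j = i then 1 else 0) * dot m (u b) (mv m A (u a)))"
      by (rule parseval[OF on])
    also have "\<dots> = (\<Sum>b<m. if b = a then u b i * dot m (u b) (mv m A (u a)) else 0)"
      using that off by (intro sum.cong refl) (auto simp: dot_commute[of m _ "\<lambda>j. if j = i then 1 else 0"] dot_unit)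
    finally show ?thesis using that by simp
  qed
  hence "eigenbasis m A (\<lambda>a. dot m (u a) (mv m A (u a))) u"
    using on by (simp add: eigenbasis_def)
  thus thesis by (rule that)
qed

section \<open>Anticoncentration of random signed sums\<close>

text \<open>
A vector of signs indexed by \<open>I\<close> is encoded by the subset \<open>E\<close> of the indices with sign \<open>+1\<close>; sums over
\<open>Pow I\<close> are then \<open>2 ^ card I\<close> times expectations over independent random signs.
\<close>

definition sg :: "nat set \<Rightarrow> nat \<Rightarrow> real" where
  "sg E i = (if i \<in> E then 1 else -1)"

definition signed_sum :: "(nat \<Rightarrow> real) \<Rightarrow> nat set \<Rightarrow> nat set \<Rightarrow> real" where
  "signed_sum w I E = (\<Sum>i\<in>I. sg E i * w i)"

lemma sum_Pow_insert:
  assumes "finite F" "x \<notin> F"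
  shows "(\<Sum>E\<in>Pow (insert x F). h E) = (\<Sum>E\<in>Pow F. h E + (h (insert x E) :: real))"
proof -
  have "(\<Sum>E\<in>Pow (insert x F). h E) = (\<Sum>E\<in>Pow F. h E) + (\<Sum>E\<in>insert x ` Pow F. h E)"
    unfolding Pow_insert using assms by (intro sum.union_disjoint) auto
  also have "(\<Sum>E\<in>insert x ` Pow F. h E) = (\<Sum>E\<in>Pow F. h (insert x E))"
    using assms by (subst sum.reindex) (auto simp: inj_on_def)
  finally show ?thesis by (simp add: sum.distrib)
qed

lemma signed_sum_insert:
  assumes "finite F" "x \<notin> F" "E \<subseteq> F"
  shows "signed_sum w (insert x F) E = - w x + signed_sum w F E"
    and "signed_sum w (insert x F) (insert x E) = w x + signed_sum w F E"
proof -
  have "x \<notin> E" using assms by auto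
  thus "signed_sum w (insert x F) E = - w x + signed_sum w F E"
    using assms by (simp add: signed_sum_def sg_def)
  have "(\<Sum>i\<in>F. sg (insert x E) i * w i) = (\<Sum>i\<in>F. sg E i * w i)"
    using assms by (intro sum.cong) (auto simp: sg_def)
  thus "signed_sum w (insert x F) (insert x E) = w x + signed_sum w F E"
    using assms by (simp add: signed_sum_def) (simp add: sg_def)
qed

lemma signed_sum_second_moment:
  assumes "finite I"
  shows "(\<Sum>E\<in>Pow I. (signed_sum w I E)\<^sup>2) = 2 ^ card I * (\<Sum>i\<in>I. (w i)\<^sup>2)"
  using assms
proof (induction I rule: finite_induct)
  case empty thus ?case by (simp add: signed_sum_def)
next
  case (insert x F)
  have "(\<Sum>E\<in>Pow (insert x F). (signed_sum w (insert x F) E)\<^sup>2)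
      = (\<Sum>E\<in>Pow F. 2 * (w x)\<^sup>2 + 2 * (signed_sum w F E)\<^sup>2)"
    using insert.hyps
    by (subst sum_Pow_insert) (auto simp: signed_sum_insert power2_eq_square algebra_simps intro!: sum.cong)
  also have "\<dots> = 2 ^ card F * (2 * (w x)\<^sup>2) + 2 * (\<Sum>E\<in>Pow F. (signed_sum w F E)\<^sup>2)"
    using insert.hyps by (simp add: sum.distrib sum_distrib_left[symmetric] card_Pow)
  finally show ?case using insert by (simp add: algebra_simps)
qed

lemma signed_sum_symmetric:
  fixes h :: "real \<Rightarrow> real"
  assumes "finite I"
  shows "(\<Sum>E\<in>Pow I. h (signed_sum w I E)) = (\<Sum>E\<in>Pow I. h (- signed_sum w I E))"
  using assms
proof (induction I arbitrary: h rule: finite_induct)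
  case empty thus ?case by (simp add: signed_sum_def)
next
  case (insert x F)
  have "(\<Sum>E\<in>Pow (insert x F). h (signed_sum w (insert x F) E))
      = (\<Sum>E\<in>Pow F. (\<lambda>r. h (- w x + r) + h (w x + r)) (signed_sum w F E))"
    using insert.hyps by (subst sum_Pow_insert) (auto simp: signed_sum_insert intro!: sum.cong)
  also have "\<dots> = (\<Sum>E\<in>Pow F. (\<lambda>r. h (- w x + r) + h (w x + r)) (- signed_sum w F E))"
    by (rule insert.IH)
  also have "\<dots> = (\<Sum>E\<in>Pow (insert x F). h (- signed_sum w (insert x F) E))"
    using insert.hyps by (subst sum_Pow_insert)
      (auto simp: signed_sum_insert add.commute intro!: sum.cong)
  finally show ?case .
qed

text \<open>
With \<open>R\<close> the signed sum, the event \<open>\<bar>R\<bar> \<le> 1 + \<bar>c\<bar>\<close> has probability at least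
\<open>1 - E R\<^sup>2 / (1 + \<bar>c\<bar>)\<^sup>2\<close> by Chebyshev's inequality. On that event \<open>c + R\<close> or \<open>c - R\<close> lies in
\<open>[-1, 1]\<close>, because \<open>\<bar>c\<bar> \<le> 1\<close>, and by symmetry of \<open>R\<close> both have the same probability to do so.
\<close>

lemma shifted_signed_sum_chebyshev:
  assumes "finite I" "\<bar>c\<bar> \<le> 1"
  shows "2 ^ card I * (1 - (\<Sum>i\<in>I. (w i)\<^sup>2) / (1 + \<bar>c\<bar>)\<^sup>2)
       \<le> 2 * (\<Sum>E\<in>Pow I. of_bool (\<bar>c + signed_sum w I E\<bar> \<le> 1) :: real)"
proof -
  let ?R = "signed_sum w I"
  have pos: "(1 + \<bar>c\<bar>)\<^sup>2 > 0" by (simp add: add_pos_nonneg)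
  have pt: "1 - r\<^sup>2 / (1 + \<bar>c\<bar>)\<^sup>2 \<le> of_bool (\<bar>c + r\<bar> \<le> 1) + of_bool (\<bar>c + - r\<bar> \<le> 1)" for r :: real
  proof (cases "\<bar>r\<bar> \<le> 1 + \<bar>c\<bar>")
    case True
    hence "\<bar>c + r\<bar> \<le> 1 \<or> \<bar>c + - r\<bar> \<le> 1" using assms(2) by linarith
    hence "(1::real) \<le> of_bool (\<bar>c + r\<bar> \<le> 1) + of_bool (\<bar>c + - r\<bar> \<le> 1)" by auto
    moreover have "0 \<le> r\<^sup>2 / (1 + \<bar>c\<bar>)\<^sup>2" by simp
    ultimately show ?thesis by linarith
  next
    case False
    hence "(1 + \<bar>c\<bar>)\<^sup>2 \<le> r\<^sup>2"
      by (metis abs_ge_zero abs_le_square_iff abs_of_nonneg add_nonneg_nonneg linear zero_le_one)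
    hence "1 \<le> r\<^sup>2 / (1 + \<bar>c\<bar>)\<^sup>2" using pos by simp
    thus ?thesis by (smt (verit) of_bool_def)
  qed
  have "2 ^ card I * (1 - (\<Sum>i\<in>I. (w i)\<^sup>2) / (1 + \<bar>c\<bar>)\<^sup>2)
      = 2 ^ card I - (\<Sum>E\<in>Pow I. (?R E)\<^sup>2) / (1 + \<bar>c\<bar>)\<^sup>2"
    by (simp add: signed_sum_second_moment[OF assms(1)] algebra_simps)
  also have "\<dots> = (\<Sum>E\<in>Pow I. 1 - (?R E)\<^sup>2 / (1 + \<bar>c\<bar>)\<^sup>2)"
    using assms(1) by (simp add: sum_subtractf sum_divide_distrib card_Pow)
  also have "\<dots> \<le> (\<Sum>E\<in>Pow I. of_bool (\<bar>c + ?R E\<bar> \<le> 1) + of_bool (\<bar>c + - ?R E\<bar> \<le> 1))"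
    by (intro sum_mono pt)
  also have "\<dots> = 2 * (\<Sum>E\<in>Pow I. of_bool (\<bar>c + ?R E\<bar> \<le> 1))"
    using signed_sum_symmetric[OF assms(1), of "\<lambda>r. of_bool (\<bar>c + r\<bar> \<le> 1)" w]
    by (simp add: sum.distrib)
  finally show ?thesis .
qed

text \<open>
The weights are added to \<open>c\<close> one by one as long as the partial sum is certain to stay in \<open>[-1, 1]\<close>.
When the next weight \<open>w\<close> could leave the interval, \<open>1 + \<bar>c\<bar> > 2 - \<bar>w\<bar>\<close>, while the remaining variance is
at most \<open>1 - a\<^sup>2 \<le> 1 - w\<^sup>2\<close>. Since \<open>(1 - w\<^sup>2) / (2 - \<bar>w\<bar>)\<^sup>2 \<le> 1 / 3\<close> (equality at \<open>\<bar>w\<bar> = 1 / 2\<close>),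
Chebyshev's inequality leaves probability at least \<open>(1 - 1 / 3) / 2 = 1 / 3\<close>.
\<close>

lemma shifted_signed_sum_small:
  assumes "finite I" "\<And>i. i \<in> I \<Longrightarrow> \<bar>w i\<bar> \<le> a" "(\<Sum>i\<in>I. (w i)\<^sup>2) \<le> 1 - a\<^sup>2" "\<bar>c\<bar> \<le> 1"
  shows "2 ^ card I / 3 \<le> (\<Sum>E\<in>Pow I. of_bool (\<bar>c + signed_sum w I E\<bar> \<le> 1) :: real)"
  using assms
proof (induction I arbitrary: c rule: finite_induct)
  case empty thus ?case by (simp add: signed_sum_def)
next
  case (insert x F)
  have fin: "finite (insert x F)" using insert.hyps by simp
  show ?case
  proof (cases "\<bar>c\<bar> + \<bar>w x\<bar> \<le> 1")
    case True
    have v: "(\<Sum>i\<in>F. (w i)\<^sup>2) \<le> 1 - a\<^sup>2"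
    proof -
      have "(\<Sum>i\<in>F. (w i)\<^sup>2) \<le> (\<Sum>i\<in>insert x F. (w i)\<^sup>2)"
        using fin by (intro sum_mono2) auto
      thus ?thesis using insert.prems(2) by linarith
    qed
    have "2 ^ card F / 3 \<le> (\<Sum>E\<in>Pow F. of_bool (\<bar>(c - w x) + signed_sum w F E\<bar> \<le> 1) :: real)"
      using True insert.prems by (intro insert.IH v) auto
    moreover have "2 ^ card F / 3 \<le> (\<Sum>E\<in>Pow F. of_bool (\<bar>(c + w x) + signed_sum w F E\<bar> \<le> 1) :: real)"
      using True insert.prems by (intro insert.IH v) auto
    moreover have "(\<Sum>E\<in>Pow (insert x F). of_bool (\<bar>c + signed_sum w (insert x F) E\<bar> \<le> 1) :: real)
      = (\<Sum>E\<in>Pow F. of_bool (\<bar>(c - w x) + signed_sum w F E\<bar> \<le> 1)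
                   + of_bool (\<bar>(c + w x) + signed_sum w F E\<bar> \<le> 1))"
      using insert.hyps by (subst sum_Pow_insert)
        (auto simp: signed_sum_insert algebra_simps intro!: sum.cong)
    ultimately show ?thesis using insert.hyps by (simp add: sum.distrib)
  next
    case False
    have "\<bar>w x\<bar> \<le> a" using insert.prems(1) by simp
    hence "(w x)\<^sup>2 \<le> a\<^sup>2" by (simp add: abs_le_square_iff[symmetric])
    hence v: "(\<Sum>i\<in>insert x F. (w i)\<^sup>2) \<le> 1 - (w x)\<^sup>2" using insert.prems(2) by linarith
    have le: "2 - \<bar>w x\<bar> \<le> 1 + \<bar>c\<bar>" using False by linarith
    have "(w x)\<^sup>2 \<le> (\<Sum>i\<in>insert x F. (w i)\<^sup>2)" using fin by (intro member_le_sum) auto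
    hence "(w x)\<^sup>2 \<le> 1" using v zero_le_power2[of "w x"] by linarith
    hence "\<bar>w x\<bar> \<le> 1" by (simp add: abs_square_le_1)
    hence "(2 - \<bar>w x\<bar>)\<^sup>2 \<le> (1 + \<bar>c\<bar>)\<^sup>2" using le by (intro power_mono) auto
    moreover have "3 - 3 * (w x)\<^sup>2 \<le> (2 - \<bar>w x\<bar>)\<^sup>2"
      using zero_le_power2[of "2 * \<bar>w x\<bar> - 1"] by (simp add: power2_eq_square algebra_simps)
    ultimately have "3 * (\<Sum>i\<in>insert x F. (w i)\<^sup>2) \<le> (1 + \<bar>c\<bar>)\<^sup>2" using v by linarith
    hence "(\<Sum>i\<in>insert x F. (w i)\<^sup>2) / (1 + \<bar>c\<bar>)\<^sup>2 \<le> 1 / 3"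
      by (simp add: divide_simps add_nonneg_eq_0_iff)
    hence "(2::real) ^ card (insert x F) * (2 / 3)
       \<le> 2 ^ card (insert x F) * (1 - (\<Sum>i\<in>insert x F. (w i)\<^sup>2) / (1 + \<bar>c\<bar>)\<^sup>2)"
      by (intro mult_left_mono) auto
    also have "\<dots> \<le> 2 * (\<Sum>E\<in>Pow (insert x F). of_bool (\<bar>c + signed_sum w (insert x F) E\<bar> \<le> 1))"
      by (rule shifted_signed_sum_chebyshev[OF fin insert.prems(3)])
    finally show ?thesis by simp
  qed
qed

text \<open>
The previous lemma is started with the weight of largest modulus as the first partial sum; this is
what bounds all later weights by \<open>a\<close> and leaves the variance \<open>1 - a\<^sup>2\<close> for them.
\<close>

theorem signed_sum_anticoncentration:
  assumes "finite I" "(\<Sum>i\<in>I. (w i)\<^sup>2) \<le> 1"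
  shows "2 ^ card I / 3 \<le> (\<Sum>E\<in>Pow I. of_bool (\<bar>signed_sum w I E\<bar> \<le> 1) :: real)"
proof (cases "I = {}")
  case True thus ?thesis by (simp add: signed_sum_def)
next
  case False
  obtain x where x: "x \<in> I" "\<And>i. i \<in> I \<Longrightarrow> \<bar>w i\<bar> \<le> \<bar>w x\<bar>"
    using obtains_MAX[OF assms(1) False, of "\<lambda>i. \<bar>w i\<bar>"] assms(1)
    by (metis (mono_tags, lifting) Max_ge finite_imageI imageI)
  define F where "F = I - {x}"
  have I: "I = insert x F" and F: "finite F" "x \<notin> F" using x assms(1) by (auto simp: F_def)
  have v: "(\<Sum>i\<in>F. (w i)\<^sup>2) \<le> 1 - \<bar>w x\<bar>\<^sup>2" using assms(2) F by (simp add: I)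
  have "(w x)\<^sup>2 \<le> 1" using v sum_nonneg[of F "\<lambda>i. (w i)\<^sup>2"] by simp
  hence wx: "\<bar>w x\<bar> \<le> 1" by (simp add: abs_square_le_1)
  have "2 ^ card F / 3 \<le> (\<Sum>E\<in>Pow F. of_bool (\<bar>- w x + signed_sum w F E\<bar> \<le> 1) :: real)"
    using x wx by (intro shifted_signed_sum_small[OF F(1) _ v]) (auto simp: F_def)
  moreover have "2 ^ card F / 3 \<le> (\<Sum>E\<in>Pow F. of_bool (\<bar>w x + signed_sum w F E\<bar> \<le> 1) :: real)"
    using x wx by (intro shifted_signed_sum_small[OF F(1) _ v]) (auto simp: F_def)
  moreover have "(\<Sum>E\<in>Pow I. of_bool (\<bar>signed_sum w I E\<bar> \<le> 1) :: real)
    = (\<Sum>E\<in>Pow F. of_bool (\<bar>- w x + signed_sum w F E\<bar> \<le> 1)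
                 + of_bool (\<bar>w x + signed_sum w F E\<bar> \<le> 1))"
    unfolding I using F by (subst sum_Pow_insert) (auto simp: signed_sum_insert intro!: sum.cong)
  ultimately show ?thesis using F by (simp add: I sum.distrib)
qed

section \<open>A tail bound for random signed sums of symmetric matrices\<close>

lemma sinh_le_mult_cosh:
  assumes "0 \<le> (x::real)" shows "sinh x \<le> x * cosh x"
proof -
  have "(\<lambda>x. x * cosh x - sinh x) 0 \<le> (\<lambda>x. x * cosh x - sinh x) x"
  proof (rule DERIV_nonneg_imp_nondecreasing[OF assms])
    fix y :: real assume "0 \<le> y"
    moreover have "((\<lambda>x. x * cosh x - sinh x) has_real_derivative y * sinh y) (at y)"
      by (rule derivative_eq_intros refl | simp)+
    ultimately show "\<exists>d. ((\<lambda>x. x * cosh x - sinh x) has_real_derivative d) (at y) \<and> 0 \<le> d"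
      by auto
  qed
  thus ?thesis by simp
qed

text \<open>
In terms of the half sum \<open>y\<close> and the half difference \<open>x\<close> of \<open>\<theta> * a\<close> and \<open>\<theta> * b\<close>, both sides contain the
factor \<open>2 * cosh y\<close>, and what remains is \<open>tanh x \<le> x\<close> for \<open>x \<ge> 0\<close>.
\<close>

lemma sinh_diff_le_cosh_mean:
  fixes a b \<theta> :: real
  assumes "0 \<le> \<theta>"
  shows "(a - b) * (sinh (\<theta> * a) - sinh (\<theta> * b))
       \<le> \<theta> / 2 * (a - b)\<^sup>2 * (cosh (\<theta> * a) + cosh (\<theta> * b))"
proof -
  define x y where "x = \<theta> * (a - b) / 2" and "y = \<theta> * (a + b) / 2"
  have ab: "\<theta> * a = y + x" "\<theta> * b = y - x" by (auto simp: x_def y_def field_simps)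
  have "(a - b) * sinh x \<le> (a - b) * (x * cosh x)"
  proof (cases "a \<ge> b")
    case True
    thus ?thesis using assms by (intro mult_left_mono sinh_le_mult_cosh) (auto simp: x_def)
  next
    case False
    have "sinh (-x) \<le> (-x) * cosh (-x)"
      using False assms by (intro sinh_le_mult_cosh) (auto simp: x_def mult_le_0_iff)
    hence "x * cosh x \<le> sinh x" by simp
    thus ?thesis using False by (intro mult_left_mono_neg) auto
  qed
  hence "2 * cosh y * ((a - b) * sinh x) \<le> 2 * cosh y * ((a - b) * (x * cosh x))"
    by (rule mult_left_mono) simp
  also have "2 * cosh y * ((a - b) * sinh x) = (a - b) * (sinh (\<theta> * a) - sinh (\<theta> * b))"
    unfolding ab sinh_add sinh_diff by (simp add: algebra_simps)
  also have "2 * cosh y * ((a - b) * (x * cosh x)) = (a - b) * x * (2 * cosh y * cosh x)"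
    by (simp add: algebra_simps)
  also have "2 * cosh y * cosh x = cosh (\<theta> * a) + cosh (\<theta> * b)"
    unfolding ab cosh_add cosh_diff by simp
  also have "(a - b) * x = \<theta> / 2 * (a - b)\<^sup>2" by (simp add: x_def power2_eq_square)
  finally show ?thesis .
qed

lemma mv_diff: "mv m (\<lambda>p q. A p q - B p q) x i = mv m A x i - mv m B x i"
  by (simp add: mv_def algebra_simps sum_subtractf)

lemma dot_diff_right: "dot m x (\<lambda>i. y i - z i) = dot m x y - dot m x z"
  by (simp add: dot_def algebra_simps sum_subtractf)

lemma dot_mv_eigen:
  assumes "eigenbasis m A lam u" "a < m"
  shows "dot m x (mv m A (u a)) = lam a * dot m x (u a)"
proof -
  have "dot m x (mv m A (u a)) = dot m x (\<lambda>i. lam a * u a i)"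
    using assms by (intro dot_cong) (auto simp: eigenbasis_def)
  thus ?thesis by (simp add: dot_def sum_distrib_left mult.left_commute)
qed

text \<open>
This is \<open>Tr (D (sinh \<theta>A - sinh \<theta>B)) \<le> \<theta>/2 * Tr (D\<^sup>2 (cosh \<theta>A + cosh \<theta>B))\<close> for \<open>D = A - B\<close>, with the traces
written in eigenbases of \<open>A\<close> and \<open>B\<close>. Although \<open>A\<close> and \<open>B\<close> need not commute, both sides are linear
combinations of the doubly stochastic weights \<open>c a b = <u\<^sub>a, w\<^sub>b>\<^sup>2\<close> whose coefficients are functions of the
two eigenvalues, so the scalar inequality for each pair \<open>\<alpha> a, \<beta> b\<close> suffices.
\<close>

lemma mean_value_trace_inequality:
  fixes A B :: "nat \<Rightarrow> nat \<Rightarrow> real"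
  assumes symA: "symm m A" and symB: "symm m B"
    and eA: "eigenbasis m A \<alpha> u" and eB: "eigenbasis m B \<beta> w" and "0 \<le> \<theta>"
  defines "D \<equiv> \<lambda>p q. A p q - B p q"
  shows "(\<Sum>a<m. sinh (\<theta> * \<alpha> a) * dot m (u a) (mv m D (u a)))
       - (\<Sum>b<m. sinh (\<theta> * \<beta> b) * dot m (w b) (mv m D (w b)))
     \<le> \<theta> / 2 * ((\<Sum>a<m. cosh (\<theta> * \<alpha> a) * dot m (mv m D (u a)) (mv m D (u a)))
             + (\<Sum>b<m. cosh (\<theta> * \<beta> b) * dot m (mv m D (w b)) (mv m D (w b))))"
proof -
  define c where "c a b = (dot m (u a) (w b))\<^sup>2" for a b
  have onu: "orthonormal m u" and onw: "orthonormal m w"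
    using eA eB by (auto simp: eigenbasis_def)
  have D: "mv m D x = (\<lambda>i. mv m A x i - mv m B x i)" for x
    by (rule ext) (simp add: D_def mv_diff)
  have wu: "dot m (w b) (mv m D (u a)) = (\<alpha> a - \<beta> b) * dot m (u a) (w b)"
    if "a < m" "b < m" for a b
    using that dot_mv_eigen[OF eA] eigenbasis_dot_mv[OF symB eB]
    by (simp only: D dot_diff_right) (simp add: dot_commute[of m "w b" "u a"] left_diff_distrib)
  have uw: "dot m (u a) (mv m D (w b)) = (\<alpha> a - \<beta> b) * dot m (u a) (w b)"
    if "a < m" "b < m" for a b
    using that dot_mv_eigen[OF eB] eigenbasis_dot_mv[OF symA eA]
    by (simp only: D dot_diff_right) (simp add: left_diff_distrib)
  have u1: "dot m (u a) (mv m D (u a)) = (\<Sum>b<m. (\<alpha> a - \<beta> b) * c a b)" if "a < m" for a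
    using that wu by (subst parseval[OF onw])
      (auto simp: c_def power2_eq_square dot_commute[of m "w _"] intro!: sum.cong)
  have u2: "dot m (mv m D (u a)) (mv m D (u a)) = (\<Sum>b<m. (\<alpha> a - \<beta> b)\<^sup>2 * c a b)"
    if "a < m" for a
    using that wu by (subst parseval[OF onw])
      (auto simp: c_def power2_eq_square mult_ac intro!: sum.cong)
  have w1: "dot m (w b) (mv m D (w b)) = (\<Sum>a<m. (\<alpha> a - \<beta> b) * c a b)" if "b < m" for b
    using that uw by (subst parseval[OF onu])
      (auto simp: c_def power2_eq_square intro!: sum.cong)
  have w2: "dot m (mv m D (w b)) (mv m D (w b)) = (\<Sum>a<m. (\<alpha> a - \<beta> b)\<^sup>2 * c a b)"
    if "b < m" for b
    using that uw by (subst parseval[OF onu])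
      (auto simp: c_def power2_eq_square mult_ac intro!: sum.cong)
  have "(\<Sum>a<m. sinh (\<theta> * \<alpha> a) * dot m (u a) (mv m D (u a)))
       - (\<Sum>b<m. sinh (\<theta> * \<beta> b) * dot m (w b) (mv m D (w b)))
     = (\<Sum>a<m. \<Sum>b<m. sinh (\<theta> * \<alpha> a) * ((\<alpha> a - \<beta> b) * c a b))
     - (\<Sum>b<m. \<Sum>a<m. sinh (\<theta> * \<beta> b) * ((\<alpha> a - \<beta> b) * c a b))"
    by (simp add: u1 w1 sum_distrib_left)
  also have "\<dots> = (\<Sum>a<m. \<Sum>b<m. c a b * ((\<alpha> a - \<beta> b) * (sinh (\<theta> * \<alpha> a) - sinh (\<theta> * \<beta> b))))"
    by (subst (2) sum.swap) (simp add: sum_subtractf[symmetric] algebra_simps)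
  also have "\<dots> \<le> (\<Sum>a<m. \<Sum>b<m. c a b *
       (\<theta> / 2 * (\<alpha> a - \<beta> b)\<^sup>2 * (cosh (\<theta> * \<alpha> a) + cosh (\<theta> * \<beta> b))))"
    using \<open>0 \<le> \<theta>\<close> by (intro sum_mono mult_left_mono sinh_diff_le_cosh_mean) (auto simp: c_def)
  also have "\<dots> = \<theta> / 2 * ((\<Sum>a<m. \<Sum>b<m. cosh (\<theta> * \<alpha> a) * ((\<alpha> a - \<beta> b)\<^sup>2 * c a b))
     + (\<Sum>a<m. \<Sum>b<m. cosh (\<theta> * \<beta> b) * ((\<alpha> a - \<beta> b)\<^sup>2 * c a b)))"
    unfolding distrib_left sum.distrib sum_distrib_left by (simp add: mult_ac)
  also have "(\<Sum>a<m. \<Sum>b<m. cosh (\<theta> * \<beta> b) * ((\<alpha> a - \<beta> b)\<^sup>2 * c a b))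
     = (\<Sum>b<m. cosh (\<theta> * \<beta> b) * dot m (mv m D (w b)) (mv m D (w b)))"
    by (subst sum.swap) (simp add: w2 sum_distrib_left)
  also have "(\<Sum>a<m. \<Sum>b<m. cosh (\<theta> * \<alpha> a) * ((\<alpha> a - \<beta> b)\<^sup>2 * c a b))
     = (\<Sum>a<m. cosh (\<theta> * \<alpha> a) * dot m (mv m D (u a)) (mv m D (u a)))"
    by (simp add: u2 sum_distrib_left)
  finally show ?thesis .
qed

definition flip :: "nat \<Rightarrow> nat set \<Rightarrow> nat set" where
  "flip i E = (if i \<in> E then E - {i} else insert i E)"

lemma sg_flip: "sg (flip i E) j = (if j = i then - sg E i else sg E j)"
  by (cases "i \<in> E"; cases "j = i") (simp_all add: flip_def sg_def)

lemma sum_Pow_flip: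
  assumes "i \<in> I"
  shows "(\<Sum>E\<in>Pow I. h (flip i E)) = (\<Sum>E\<in>Pow I. h E)"
proof (rule sum.reindex_bij_witness[of _ "flip i" "flip i"])
  fix E
  show "flip i (flip i E) = E" "flip i (flip i E) = E" by (auto simp: flip_def)
  show "flip i E \<in> Pow I" "flip i E \<in> Pow I" if "E \<in> Pow I"
    using that assms by (auto simp: flip_def)
qed simp

definition signed_mat :: "nat \<Rightarrow> (nat \<Rightarrow> nat \<Rightarrow> nat \<Rightarrow> real) \<Rightarrow> nat set \<Rightarrow> nat \<Rightarrow> nat \<Rightarrow> real" where
  "signed_mat N A E = (\<lambda>p q. \<Sum>i<N. sg E i * A i p q)"

lemma symm_signed_mat:
  "(\<And>i. i < N \<Longrightarrow> symm m (A i)) \<Longrightarrow> symm m (signed_mat N A E)"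
  by (auto simp: symm_def signed_mat_def intro!: sum.cong)

lemma mv_signed_mat:
  "mv m (signed_mat N A E) x = (\<lambda>p. \<Sum>i<N. sg E i * mv m (A i) x p)"
  unfolding mv_def signed_mat_def sum_distrib_left sum_distrib_right
  by (rule ext, subst sum.swap) (simp add: mult_ac)

lemma sg_square: "sg E i * sg E i = 1"
  by (simp add: sg_def)

text \<open>
In the following context \<open>X\<^sub>E = signed_mat N A E\<close> is a random symmetric matrix with \<open>\<Sum>i. A\<^sub>i\<^sup>2 \<le> \<sigma> I\<close>,
and \<open>\<Sum>a<m. cosh (\<theta> * lam E a)\<close> is the trace of \<open>cosh (\<theta> X\<^sub>E)\<close>.
\<close>

context
  fixes N m :: nat and A :: "nat \<Rightarrow> nat \<Rightarrow> nat \<Rightarrow> real" and \<sigma> :: real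
    and lam :: "nat set \<Rightarrow> nat \<Rightarrow> real" and u :: "nat set \<Rightarrow> nat \<Rightarrow> nat \<Rightarrow> real"
  assumes sym: "\<And>i. i < N \<Longrightarrow> symm m (A i)"
    and var: "\<And>v. (\<Sum>i<N. dot m (mv m (A i) v) (mv m (A i) v)) \<le> \<sigma> * dot m v v"
    and eig: "\<And>E. eigenbasis m (signed_mat N A E) (lam E) (u E)"
begin

text \<open>
The left-hand side is the sum over all signs of \<open>Tr (X sinh \<theta>X) = \<Sum>i. \<epsilon>\<^sub>i Tr (A\<^sub>i sinh \<theta>X)\<close>. For fixed \<open>i\<close>
the signs are paired by flipping the \<open>i\<close>-th one, which changes \<open>X\<close> by \<open>2 \<epsilon>\<^sub>i A\<^sub>i\<close>; the mean value trace
inequality bounds the contribution of a pair by \<open>\<theta> Tr (A\<^sub>i\<^sup>2 cosh \<theta>X)\<close> summed over the pair. Summing over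
\<open>i\<close> produces \<open>\<Sum>i. A\<^sub>i\<^sup>2\<close>, which is where the joint bound \<open>\<sigma> I\<close> enters.
\<close>

lemma khintchine_derivative_bound:
  assumes "0 \<le> \<theta>"
  shows "(\<Sum>E\<in>Pow {..<N}. \<Sum>a<m. lam E a * sinh (\<theta> * lam E a))
       \<le> \<theta> * \<sigma> * (\<Sum>E\<in>Pow {..<N}. \<Sum>a<m. cosh (\<theta> * lam E a))"
proof -
  define H where "H i E = (\<Sum>a<m. sinh (\<theta> * lam E a) * dot m (u E a) (mv m (A i) (u E a)))" for i E
  define C where "C i E = (\<Sum>a<m. cosh (\<theta> * lam E a) * dot m (mv m (A i) (u E a)) (mv m (A i) (u E a)))"
    for i E
  have on: "dot m (u E a) (u E a) = 1" if "a < m" for E a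
    using eig[of E] that by (simp add: eigenbasis_def orthonormal_def)
  have flip_le: "sg E i * (H i E - H i (flip i E)) \<le> \<theta> * (C i E + C i (flip i E))"
    if i: "i < N" for i E
  proof -
    let ?D = "\<lambda>p q. signed_mat N A E p q - signed_mat N A (flip i E) p q"
    have "?D = (\<lambda>p q. (2 * sg E i) * A i p q)"
    proof (intro ext)
      fix p q
      have "?D p q = (\<Sum>j<N. if j = i then 2 * sg E i * A i p q else 0)"
        unfolding signed_mat_def sum_subtractf[symmetric] by (intro sum.cong) (auto simp: sg_flip)
      thus "?D p q = (2 * sg E i) * A i p q" using i by simp
    qed
    hence D: "mv m ?D x = (\<lambda>p. (2 * sg E i) * mv m (A i) x p)" for x
      by (simp add: mv_def sum_distrib_left mult.assoc)
    have d1: "dot m x (mv m ?D x) = 2 * sg E i * dot m x (mv m (A i) x)" for x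
      unfolding D dot_def sum_distrib_left by (simp only: mult_ac)
    have d2: "dot m (mv m ?D x) (mv m ?D x) = 4 * dot m (mv m (A i) x) (mv m (A i) x)" for x
    proof -
      have "(2 * sg E i) * y * ((2 * sg E i) * y) = 4 * (y * y)" for y
        by (simp add: sg_def)
      thus ?thesis unfolding D unfolding dot_def sum_distrib_left
        by (intro sum.cong refl) (simp only:)
    qed
    have h: "(\<Sum>a<m. sinh (\<theta> * lam G a) * (2 * sg E i * dot m (u G a) (mv m (A i) (u G a))))
        = 2 * sg E i * H i G" for G
      by (simp add: H_def sum_distrib_left mult_ac)
    have c: "(\<Sum>a<m. cosh (\<theta> * lam G a) * (4 * dot m (mv m (A i) (u G a)) (mv m (A i) (u G a))))
        = 4 * C i G" for G
      by (simp add: C_def sum_distrib_left mult_ac)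
    have "2 * sg E i * H i E - 2 * sg E i * H i (flip i E) \<le> \<theta> / 2 * (4 * C i E + 4 * C i (flip i E))"
      using mean_value_trace_inequality[OF symm_signed_mat[of N m A E, OF sym]
          symm_signed_mat[of N m A "flip i E", OF sym] eig[of E] eig[of "flip i E"] assms]
      unfolding d1 d2 h c by simp
    hence "2 * (sg E i * (H i E - H i (flip i E))) \<le> 2 * (\<theta> * (C i E + C i (flip i E)))"
      by (simp add: distrib_left right_diff_distrib mult.assoc)
    thus ?thesis by simp
  qed
  have i_le: "(\<Sum>E\<in>Pow {..<N}. sg E i * H i E) \<le> \<theta> * (\<Sum>E\<in>Pow {..<N}. C i E)" if i: "i < N" for i
  proof -
    have "2 * (\<Sum>E\<in>Pow {..<N}. sg E i * H i E)
      = (\<Sum>E\<in>Pow {..<N}. sg E i * H i E) + (\<Sum>E\<in>Pow {..<N}. sg (flip i E) i * H i (flip i E))"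
      using i by (subst sum_Pow_flip) auto
    also have "\<dots> = (\<Sum>E\<in>Pow {..<N}. sg E i * (H i E - H i (flip i E)))"
      unfolding sum.distrib[symmetric]
      by (intro sum.cong refl) (simp add: sg_flip right_diff_distrib)
    also have "\<dots> \<le> (\<Sum>E\<in>Pow {..<N}. \<theta> * (C i E + C i (flip i E)))"
      using i by (intro sum_mono flip_le)
    also have "\<dots> = \<theta> * ((\<Sum>E\<in>Pow {..<N}. C i E) + (\<Sum>E\<in>Pow {..<N}. C i (flip i E)))"
      unfolding sum_distrib_left[symmetric] sum.distrib ..
    also have "(\<Sum>E\<in>Pow {..<N}. C i (flip i E)) = (\<Sum>E\<in>Pow {..<N}. C i E)"
      using i by (intro sum_Pow_flip) auto
    finally show ?thesis by simp
  qed
  have "(\<Sum>E\<in>Pow {..<N}. \<Sum>a<m. lam E a * sinh (\<theta> * lam E a))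
      = (\<Sum>E\<in>Pow {..<N}. \<Sum>i<N. sg E i * H i E)"
  proof (rule sum.cong[OF refl])
    fix E
    have "lam E a * sinh (\<theta> * lam E a)
        = (\<Sum>i<N. sg E i * (sinh (\<theta> * lam E a) * dot m (u E a) (mv m (A i) (u E a))))"
      if a: "a < m" for a
    proof -
      have "lam E a = dot m (u E a) (mv m (signed_mat N A E) (u E a))"
        using a on by (simp add: dot_mv_eigen[OF eig])
      also have "\<dots> = (\<Sum>i<N. sg E i * dot m (u E a) (mv m (A i) (u E a)))"
        unfolding mv_signed_mat by (rule dot_lin_right)
      finally have l: "lam E a = (\<Sum>i<N. sg E i * dot m (u E a) (mv m (A i) (u E a)))" .
      have "(\<Sum>i<N. sg E i * (s * dot m (u E a) (mv m (A i) (u E a)))) = lam E a * s" for s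
        unfolding l sum_distrib_right by (simp only: mult_ac)
      thus ?thesis by simp
    qed
    hence "(\<Sum>a<m. lam E a * sinh (\<theta> * lam E a))
        = (\<Sum>a<m. \<Sum>i<N. sg E i * (sinh (\<theta> * lam E a) * dot m (u E a) (mv m (A i) (u E a))))"
      by (intro sum.cong) auto
    also have "\<dots> = (\<Sum>i<N. sg E i * H i E)"
      by (subst sum.swap) (simp add: H_def sum_distrib_left)
    finally show "(\<Sum>a<m. lam E a * sinh (\<theta> * lam E a)) = (\<Sum>i<N. sg E i * H i E)" .
  qed
  also have "\<dots> = (\<Sum>i<N. \<Sum>E\<in>Pow {..<N}. sg E i * H i E)" by (rule sum.swap)
  also have "\<dots> \<le> (\<Sum>i<N. \<theta> * (\<Sum>E\<in>Pow {..<N}. C i E))" by (intro sum_mono i_le) auto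
  also have "\<dots> = \<theta> * (\<Sum>E\<in>Pow {..<N}. \<Sum>i<N. C i E)"
    by (subst sum.swap) (simp add: sum_distrib_left)
  also have "\<dots> \<le> \<theta> * (\<Sum>E\<in>Pow {..<N}. \<sigma> * (\<Sum>a<m. cosh (\<theta> * lam E a)))"
  proof (intro mult_left_mono sum_mono assms)
    fix E
    have "(\<Sum>i<N. C i E) = (\<Sum>a<m. cosh (\<theta> * lam E a) *
        (\<Sum>i<N. dot m (mv m (A i) (u E a)) (mv m (A i) (u E a))))"
      unfolding C_def sum_distrib_left by (rule sum.swap)
    also have "\<dots> \<le> (\<Sum>a<m. cosh (\<theta> * lam E a) * (\<sigma> * dot m (u E a) (u E a)))"
      by (intro sum_mono mult_left_mono var) auto
    also have "\<dots> = \<sigma> * (\<Sum>a<m. cosh (\<theta> * lam E a))"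
      using on by (simp add: sum_distrib_left mult_ac)
    finally show "(\<Sum>i<N. C i E) \<le> \<sigma> * (\<Sum>a<m. cosh (\<theta> * lam E a))" .
  qed
  finally show ?thesis by (simp add: sum_distrib_left mult_ac)
qed

text \<open>
The bound on the derivative says that \<open>\<Psi> t * exp (- \<sigma> t\<^sup>2 / 2)\<close> does not increase for \<open>t \<ge> 0\<close>, where
\<open>\<Psi> t\<close> is the left-hand side at \<open>t\<close>.
\<close>

lemma khintchine_cosh_moment:
  assumes "0 \<le> \<theta>"
  shows "(\<Sum>E\<in>Pow {..<N}. \<Sum>a<m. cosh (\<theta> * lam E a)) \<le> 2 ^ N * real m * exp (\<sigma> * \<theta>\<^sup>2 / 2)"
proof -
  define \<Psi> where "\<Psi> t = (\<Sum>E\<in>Pow {..<N}. \<Sum>a<m. cosh (t * lam E a))" for t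
  define \<Psi>' where "\<Psi>' t = (\<Sum>E\<in>Pow {..<N}. \<Sum>a<m. lam E a * sinh (t * lam E a))" for t
  have d: "(\<Psi> has_real_derivative \<Psi>' t) (at t)" for t
  proof -
    have "((\<lambda>t. cosh (t * l)) has_real_derivative l * sinh (t * l)) (at t)" for l :: real
      using has_field_derivative_cosh[OF DERIV_cmult_right[OF DERIV_ident, of l], of t UNIV]
      by (simp add: mult.commute)
    thus ?thesis unfolding \<Psi>_def \<Psi>'_def by (intro DERIV_sum)
  qed
  have "\<Psi> \<theta> * exp (- (\<sigma> * \<theta>\<^sup>2 / 2)) \<le> \<Psi> 0 * exp (- (\<sigma> * 0\<^sup>2 / 2))"
  proof (rule DERIV_nonpos_imp_nonincreasing[OF assms])
    fix t :: real assume "0 \<le> t"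
    hence "\<Psi>' t \<le> t * \<sigma> * \<Psi> t"
      unfolding \<Psi>_def \<Psi>'_def by (rule khintchine_derivative_bound)
    hence "(\<Psi>' t - t * \<sigma> * \<Psi> t) * exp (- (\<sigma> * t\<^sup>2 / 2)) \<le> 0"
      by (intro mult_nonpos_nonneg) simp_all
    moreover have "((\<lambda>t. \<Psi> t * exp (- (\<sigma> * t\<^sup>2 / 2))) has_real_derivative
        (\<Psi>' t - t * \<sigma> * \<Psi> t) * exp (- (\<sigma> * t\<^sup>2 / 2))) (at t)"
    proof -
      have "((\<lambda>t. exp (- (\<sigma> * t\<^sup>2 / 2))) has_real_derivative
          exp (- (\<sigma> * t\<^sup>2 / 2)) * - (\<sigma> * t)) (at t)"
        by (rule DERIV_fun_exp) (auto intro!: derivative_eq_intros)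
      from DERIV_mult[OF d this] show ?thesis
        by (rule DERIV_cong) (simp add: left_diff_distrib)
    qed
    ultimately show "\<exists>d. ((\<lambda>t. \<Psi> t * exp (- (\<sigma> * t\<^sup>2 / 2))) has_real_derivative d) (at t) \<and> d \<le> 0"
      by blast
  qed
  moreover have "\<Psi> 0 = 2 ^ N * real m" by (simp add: \<Psi>_def card_Pow)
  ultimately have "\<Psi> \<theta> * exp (- (\<sigma> * \<theta>\<^sup>2 / 2)) \<le> 2 ^ N * real m" by simp
  hence "\<Psi> \<theta> * exp (- (\<sigma> * \<theta>\<^sup>2 / 2)) * exp (\<sigma> * \<theta>\<^sup>2 / 2) \<le> 2 ^ N * real m * exp (\<sigma> * \<theta>\<^sup>2 / 2)"
    by (rule mult_right_mono) simp
  also have "\<Psi> \<theta> * exp (- (\<sigma> * \<theta>\<^sup>2 / 2)) * exp (\<sigma> * \<theta>\<^sup>2 / 2) = \<Psi> \<theta>"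
    unfolding mult.assoc exp_add[symmetric] by simp
  finally show ?thesis by (simp only: \<Psi>_def)
qed

end

text \<open>
This is the probability that \<open>X\<^sup>2 \<le> r \<sigma> I\<close> fails. On that event some eigenvalue satisfies
\<open>\<lambda>\<^sup>2 > r \<sigma>\<close>, so \<open>Tr cosh (\<theta>X) \<ge> exp r / 2\<close> for \<open>\<theta> = sqrt (r / \<sigma>)\<close>, and Markov's inequality applies. Using
\<open>cosh\<close> handles both ends of the spectrum at once; it is the source of the factor \<open>2\<close>. For \<open>\<sigma> = 0\<close> all
\<open>A\<^sub>i\<close> vanish on the relevant indices.
\<close>

theorem matrix_khintchine_tail:
  assumes sym: "\<And>i. i < N \<Longrightarrow> symm m (A i)" and "0 \<le> \<sigma>" "0 < r"
    and var: "\<And>v. (\<Sum>i<N. dot m (mv m (A i) v) (mv m (A i) v)) \<le> \<sigma> * dot m v v"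
  shows "(\<Sum>E\<in>Pow {..<N}. of_bool (\<exists>v. r * \<sigma> * dot m v v
            < dot m (mv m (signed_mat N A E) v) (mv m (signed_mat N A E) v)) :: real)
       \<le> 2 ^ N * (2 * real m * exp (- r / 2))"
proof (cases "\<sigma> = 0")
  case True
  have "mv m (A i) v p = 0" if "i < N" "p < m" for i p v
  proof -
    have "(\<Sum>i<N. dot m (mv m (A i) v) (mv m (A i) v)) = 0"
    proof (rule antisym)
      show "(\<Sum>i<N. dot m (mv m (A i) v) (mv m (A i) v)) \<le> 0" using var[of v] True by simp
    qed (intro sum_nonneg dot_self_nonneg)
    hence "dot m (mv m (A i) v) (mv m (A i) v) = 0"
      using that(1) by (intro sum_nonneg_0[of "{..<N}" "\<lambda>i. dot m (mv m (A i) v) (mv m (A i) v)" i])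
        (auto simp: dot_self_nonneg)
    hence "mv m (A i) v p * mv m (A i) v p = 0"
      using that(2) unfolding dot_def
      by (intro sum_nonneg_0[of "{..<m}" "\<lambda>p. mv m (A i) v p * mv m (A i) v p" p]) auto
    thus ?thesis by simp
  qed
  hence "mv m (signed_mat N A E) v p = 0" if "p < m" for E v p
    using that by (simp add: mv_signed_mat)
  hence "dot m (mv m (signed_mat N A E) v) (mv m (signed_mat N A E) v) = 0" for E v
    by (simp add: dot_def)
  thus ?thesis by (simp add: True)
next
  case False
  hence \<sigma>: "\<sigma> > 0" using assms(2) by simp
  define bad where "bad E \<longleftrightarrow> (\<exists>v. r * \<sigma> * dot m v v
            < dot m (mv m (signed_mat N A E) v) (mv m (signed_mat N A E) v))" for E
  have "\<exists>l w. eigenbasis m (signed_mat N A E) l w" for E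
    by (rule spectral_theorem[OF symm_signed_mat[OF sym]]) blast+
  then obtain lam u where eig: "\<And>E. eigenbasis m (signed_mat N A E) (lam E) (u E)"
    by metis
  define \<theta> where "\<theta> = sqrt (r / \<sigma>)"
  have \<theta>: "0 \<le> \<theta>" "\<sigma> * \<theta>\<^sup>2 = r" using \<sigma> assms(3) by (auto simp: \<theta>_def)
  have pt: "of_bool (bad E) * (exp r / 2) \<le> (\<Sum>a<m. cosh (\<theta> * lam E a))" for E
  proof (cases "bad E")
    case False
    thus ?thesis by (simp add: sum_nonneg)
  next
    case True
    then obtain v where v: "r * \<sigma> * dot m v v
            < dot m (mv m (signed_mat N A E) v) (mv m (signed_mat N A E) v)"
      by (auto simp: bad_def)
    have "\<exists>a<m. r * \<sigma> < (lam E a)\<^sup>2"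
    proof (rule ccontr)
      assume "\<not> ?thesis"
      hence le: "(lam E a)\<^sup>2 \<le> r * \<sigma>" if "a < m" for a using that by force
      have on: "orthonormal m (u E)" using eig by (simp add: eigenbasis_def)
      have "dot m (mv m (signed_mat N A E) v) (mv m (signed_mat N A E) v)
          = (\<Sum>a<m. (lam E a)\<^sup>2 * (dot m (u E a) v)\<^sup>2)"
        by (subst parseval[OF on])
          (simp add: eigenbasis_dot_mv[OF symm_signed_mat[OF sym] eig] power2_eq_square mult_ac)
      also have "\<dots> \<le> (\<Sum>a<m. r * \<sigma> * (dot m (u E a) v)\<^sup>2)"
        using le by (intro sum_mono mult_right_mono) auto
      also have "\<dots> = r * \<sigma> * dot m v v"
        by (subst parseval[OF on]) (simp add: power2_eq_square sum_distrib_left)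
      finally show False using v by simp
    qed
    then obtain a where a: "a < m" "r * \<sigma> < (lam E a)\<^sup>2" by blast
    have "r\<^sup>2 = \<theta>\<^sup>2 * (r * \<sigma>)" using \<theta>(2) by (simp add: power2_eq_square mult_ac)
    also have "\<dots> \<le> \<theta>\<^sup>2 * (lam E a)\<^sup>2" using a by (intro mult_left_mono) auto
    finally have "r\<^sup>2 \<le> (\<theta> * lam E a)\<^sup>2" by (simp add: power_mult_distrib)
    hence "r \<le> \<bar>\<theta> * lam E a\<bar>" using assms(3) by (simp add: abs_le_square_iff[symmetric])
    hence "exp r / 2 \<le> exp \<bar>\<theta> * lam E a\<bar> / 2" by simp
    also have "\<dots> \<le> cosh \<bar>\<theta> * lam E a\<bar>" by (simp add: cosh_field_def)
    also have "\<dots> \<le> (\<Sum>a<m. cosh (\<theta> * lam E a))"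
      unfolding cosh_real_abs using a by (intro member_le_sum) auto
    finally show ?thesis using True by simp
  qed
  have "(\<Sum>E\<in>Pow {..<N}. of_bool (bad E)) * (exp r / 2) \<le> (\<Sum>E\<in>Pow {..<N}. \<Sum>a<m. cosh (\<theta> * lam E a))"
    unfolding sum_distrib_right by (intro sum_mono pt)
  also have "\<dots> \<le> 2 ^ N * real m * exp (\<sigma> * \<theta>\<^sup>2 / 2)"
    by (rule khintchine_cosh_moment[OF sym var eig \<theta>(1)])
  also have "\<dots> = 2 ^ N * (2 * real m * exp (- r / 2)) * (exp r / 2)"
    using \<theta>(2) by (simp add: mult.assoc exp_add[symmetric])
  finally show ?thesis unfolding bad_def[symmetric] by simp
qed

section \<open>Randomized rounding\<close>

definition lin :: "nat \<Rightarrow> (nat \<Rightarrow> nat \<Rightarrow> nat \<Rightarrow> real) \<Rightarrow> (nat \<Rightarrow> real) \<Rightarrow> nat \<Rightarrow> nat \<Rightarrow> real" where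
  "lin nb S z = (\<lambda>p q. \<Sum>i<nb. z i * S i p q)"

lemma symm_lin: "(\<And>i. i < nb \<Longrightarrow> symm m (S i)) \<Longrightarrow> symm m (lin nb S z)"
  unfolding symm_def lin_def by (intro allI impI sum.cong refl) simp

lemma lin_sum: "lin nb S (\<lambda>c. \<Sum>j\<in>J. a j * z j c) = (\<lambda>p q. \<Sum>j\<in>J. a j * lin nb S (z j) p q)"
  unfolding lin_def sum_distrib_left sum_distrib_right
  by (intro ext, subst sum.swap) (simp add: mult.assoc)

lemma mv_lin_sum:
  "mv m (lin nb S (\<lambda>c. \<Sum>j\<in>J. a j * z j c)) v = (\<lambda>p. \<Sum>j\<in>J. a j * mv m (lin nb S (z j)) v p)"
  unfolding lin_sum mv_def sum_distrib_left sum_distrib_right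
  by (intro ext, subst sum.swap) (simp add: mult.assoc)

lemma mv_lin_scale: "mv m (lin nb S (\<lambda>c. a * z c)) v = (\<lambda>p. a * mv m (lin nb S z) v p)"
  using mv_lin_sum[of m nb S "\<lambda>_. a" "\<lambda>_. z" "{0::nat}" v] by simp

lemma dot_scale: "dot m (\<lambda>i. a * x i) y = a * dot m x y" "dot m x (\<lambda>i. a * y i) = a * dot m x y"
  by (simp_all add: dot_def sum_distrib_left mult_ac)

lemma mv_scale: "mv m A (\<lambda>i. a * x i) = (\<lambda>i. a * mv m A x i)"
  by (simp add: mv_def sum_distrib_left mult_ac)

lemma eigenvalue_sum:
  assumes "eigenbasis N G lam u"
  shows "(\<Sum>a<N. lam a) = (\<Sum>j<N. G j j)"
proof -
  have on: "orthonormal N u" using assms by (simp add: eigenbasis_def)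
  have "(\<Sum>a<N. lam a) = (\<Sum>a<N. dot N (u a) (mv N G (u a)))"
    using on by (intro sum.cong refl) (simp add: dot_mv_eigen[OF assms] orthonormal_def)
  also have "\<dots> = (\<Sum>a<N. \<Sum>j<N. \<Sum>l<N. G j l * (u a j * u a l))"
    by (simp add: dot_def mv_def sum_distrib_left mult_ac)
  also have "\<dots> = (\<Sum>j<N. \<Sum>l<N. \<Sum>a<N. G j l * (u a j * u a l))"
  proof -
    have "(\<Sum>a<N. \<Sum>j<N. \<Sum>l<N. G j l * (u a j * u a l))
        = (\<Sum>j<N. \<Sum>a<N. \<Sum>l<N. G j l * (u a j * u a l))" by (rule sum.swap)
    also have "\<dots> = (\<Sum>j<N. \<Sum>l<N. \<Sum>a<N. G j l * (u a j * u a l))"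
      by (intro sum.cong refl sum.swap)
    finally show ?thesis .
  qed
  also have "\<dots> = (\<Sum>j<N. \<Sum>l<N. if l = j then G j l else 0)"
    by (intro sum.cong refl) (simp add: sum_distrib_left[symmetric] orthonormal_complete[OF on])
  finally show ?thesis by simp
qed

definition quad :: "nat \<Rightarrow> (nat \<Rightarrow> nat \<Rightarrow> real) \<Rightarrow> (nat \<Rightarrow> real) \<Rightarrow> (nat \<Rightarrow> real) \<Rightarrow> real" where
  "quad nb B b z = dot nb z (mv nb B z) + 2 * dot nb b z"

lemma sign_combination_dot:
  assumes "orthonormal N u" "a < N"
  shows "dot N (u a) (\<lambda>j. \<Sum>i<N. sg E i * u i j) = sg E a"
proof -
  have "dot N (u a) (\<lambda>j. \<Sum>i<N. sg E i * u i j) = (\<Sum>i<N. sg E i * dot N (u a) (u i))"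
    by (rule dot_lin_right)
  also have "\<dots> = (\<Sum>i<N. if i = a then sg E i else 0)"
    using assms by (intro sum.cong refl) (auto simp: orthonormal_def)
  finally show ?thesis using assms by simp
qed

lemma symm_gram:
  assumes "symm nb B"
  shows "symm N (\<lambda>j l. r j * r l * (dot nb (z j) (mv nb B (z l)) + dot nb b (z j) + dot nb b (z l)))"
proof -
  have "dot nb (z j) (mv nb B (z l)) = dot nb (z l) (mv nb B (z j))" for j l
    unfolding mv_self_adjoint[OF assms, of "z j"] by (rule dot_commute)
  hence "r j * r l * (dot nb (z j) (mv nb B (z l)) + dot nb b (z j) + dot nb b (z l))
       = r l * r j * (dot nb (z l) (mv nb B (z j)) + dot nb b (z l) + dot nb b (z j))" for j l
    by (simp add: mult.commute[of "r j"])
  thus ?thesis unfolding symm_def by blast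
qed

text \<open>
The vectors \<open>r\<^sub>j (z\<^sub>j, 1)\<close> are recombined by an eigenbasis \<open>u\<close> of their Gram matrix \<open>G\<close> with respect to the
homogenised form \<open>(z, \<alpha>) \<mapsto> <z, B z> + 2 \<alpha> <b, z>\<close>. The new vectors are orthogonal for this
indefinite form, so a signed sum of them has the same value for every choice of signs, namely the trace
of \<open>G\<close>.
\<close>

lemma quadratic_value_constant_on_signs:
  fixes z :: "nat \<Rightarrow> nat \<Rightarrow> real" and r b :: "nat \<Rightarrow> real" and B :: "nat \<Rightarrow> nat \<Rightarrow> real"
    and nb N :: nat and E :: "nat set" and u :: "nat \<Rightarrow> nat \<Rightarrow> real"
  defines "G \<equiv> \<lambda>j l. r j * r l * (dot nb (z j) (mv nb B (z l)) + dot nb b (z j) + dot nb b (z l))"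
  assumes sym: "symm nb B" and eig: "eigenbasis N G lam u"
  defines "w \<equiv> \<lambda>j. \<Sum>i<N. sg E i * u i j"
  defines "Y \<equiv> \<lambda>c. \<Sum>j<N. w j * r j * z j c"
  shows "dot nb Y (mv nb B Y) + 2 * (\<Sum>j<N. w j * r j) * dot nb b Y
       = (\<Sum>j<N. (r j)\<^sup>2 * quad nb B b (z j))"
proof -
  let ?c = "\<lambda>j. w j * r j"
  have on: "orthonormal N u" using eig by (simp add: eigenbasis_def)
  have symG: "symm N G"
    unfolding G_def by (rule symm_gram[OF sym])
  have YB: "dot nb Y (mv nb B Y) = (\<Sum>j<N. \<Sum>l<N. ?c j * ?c l * dot nb (z j) (mv nb B (z l)))"
    unfolding Y_def mv_lin dot_lin_left dot_lin_right sum_distrib_left by (simp only: mult.assoc)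
  have Yb: "dot nb b Y = (\<Sum>j<N. ?c j * dot nb b (z j))"
    unfolding Y_def by (rule dot_lin_right)
  have "2 * (\<Sum>j<N. ?c j) * dot nb b Y
      = (\<Sum>j<N. ?c j) * (\<Sum>l<N. ?c l * dot nb b (z l)) + (\<Sum>j<N. ?c j * dot nb b (z j)) * (\<Sum>l<N. ?c l)"
    unfolding Yb by (simp add: mult.commute)
  also have "\<dots> = (\<Sum>j<N. \<Sum>l<N. ?c j * ?c l * (dot nb b (z j) + dot nb b (z l)))"
    unfolding sum_product sum.distrib[symmetric]
    by (intro sum.cong refl) (simp only: distrib_left mult_ac add.commute)
  finally have "dot nb Y (mv nb B Y) + 2 * (\<Sum>j<N. ?c j) * dot nb b Y
      = (\<Sum>j<N. \<Sum>l<N. ?c j * ?c l * dot nb (z j) (mv nb B (z l))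
          + ?c j * ?c l * (dot nb b (z j) + dot nb b (z l)))"
    unfolding YB sum.distrib by simp
  also have "\<dots> = (\<Sum>j<N. \<Sum>l<N. w j * (G j l * w l))"
    unfolding G_def by (intro sum.cong refl) (simp add: algebra_simps)
  also have "\<dots> = dot N w (mv N G w)"
    by (simp only: dot_def mv_def sum_distrib_left)
  also have "\<dots> = (\<Sum>a<N. dot N (u a) w * dot N (u a) (mv N G w))"
    by (rule parseval[OF on])
  also have "\<dots> = (\<Sum>a<N. lam a)"
    by (intro sum.cong refl)
      (simp add: eigenbasis_dot_mv[OF symG eig] w_def sign_combination_dot[OF on] sg_square
        mult.left_commute)
  also have "\<dots> = (\<Sum>j<N. G j j)" by (rule eigenvalue_sum[OF eig])
  also have "\<dots> = (\<Sum>j<N. (r j)\<^sup>2 * quad nb B b (z j))"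
    by (intro sum.cong refl) (simp add: G_def quad_def power2_eq_square)
  finally show ?thesis .
qed

text \<open>
Recombining the vectors by an orthonormal system leaves their second moment unchanged.
\<close>

lemma rotated_variance:
  assumes on: "orthonormal N u"
  shows "(\<Sum>i<N. dot m (mv m (lin nb S (\<lambda>c. \<Sum>j<N. u i j * r j * z j c)) v)
                      (mv m (lin nb S (\<lambda>c. \<Sum>j<N. u i j * r j * z j c)) v))
       = (\<Sum>j<N. (r j)\<^sup>2 * dot m (mv m (lin nb S (z j)) v) (mv m (lin nb S (z j)) v))"
proof -
  define M where "M j = mv m (lin nb S (z j)) v" for j
  have "(\<Sum>i<N. dot m (mv m (lin nb S (\<lambda>c. \<Sum>j<N. u i j * r j * z j c)) v)
                      (mv m (lin nb S (\<lambda>c. \<Sum>j<N. u i j * r j * z j c)) v))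
      = (\<Sum>i<N. \<Sum>p<m. dot N (u i) (\<lambda>j. r j * M j p) * dot N (u i) (\<lambda>j. r j * M j p))"
    unfolding mv_lin_sum by (simp add: dot_def M_def mult.assoc)
  also have "\<dots> = (\<Sum>p<m. dot N (\<lambda>j. r j * M j p) (\<lambda>j. r j * M j p))"
    by (subst sum.swap) (simp only: parseval[OF on, symmetric])
  also have "\<dots> = (\<Sum>j<N. \<Sum>p<m. (r j)\<^sup>2 * (M j p * M j p))"
    unfolding dot_def by (subst sum.swap) (simp add: power2_eq_square mult_ac)
  finally show ?thesis by (simp only: dot_def M_def sum_distrib_left)
qed

text \<open>
The data \<open>p, z\<close> describe a distribution of points, with the missing mass at the origin, that satisfies
the constraints on average and has mean objective above \<open>\<xi>\<close>. One point with the same objective bound is obtained as \<open>(Y, s)\<close>, a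
random signed sum of the recombined vectors \<open>r\<^sub>j (z\<^sub>j, 1)\<close>. Its homogenised value is always above \<open>\<xi>\<close>,
so two random events remain: each constraint \<open>k\<close> fails with probability at most
\<open>2 * f k * exp (- \<kappa> / 2)\<close>, in total at most \<open>1 / 4\<close> by the choice of \<open>\<kappa>\<close>, while \<open>\<bar>s\<bar> \<le> 1\<close> holds with
probability at least \<open>1 / 3\<close>. Hence some choice of signs meets all requirements, and as the value is affine
in \<open>s\<close>, replacing \<open>s\<close> by \<open>1\<close> or \<open>-1\<close> does not decrease it. The value \<open>-1\<close> corresponds to the point
\<open>- Y\<close>.
\<close>

theorem randomized_rounding:
  fixes f :: "'k::finite \<Rightarrow> nat" and S :: "'k \<Rightarrow> nat \<Rightarrow> nat \<Rightarrow> nat \<Rightarrow> real"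
    and B :: "nat \<Rightarrow> nat \<Rightarrow> real" and b p :: "nat \<Rightarrow> real"
    and \<sigma> :: "'k \<Rightarrow> real" and z :: "nat \<Rightarrow> nat \<Rightarrow> real" and N :: nat
  assumes symB: "symm nb B" and symS: "\<And>k i. i < nb \<Longrightarrow> symm (f k) (S k i)"
    and f: "\<And>k. f k \<ge> 1" and \<sigma>: "\<And>k. 0 \<le> \<sigma> k"
    and p: "\<And>j. j < N \<Longrightarrow> 0 \<le> p j" and p1: "(\<Sum>j<N. p j) \<le> 1"
    and var: "\<And>k v. (\<Sum>j<N. p j * dot (f k) (mv (f k) (lin nb (S k) (z j)) v)
                 (mv (f k) (lin nb (S k) (z j)) v)) \<le> \<sigma> k * dot (f k) v v"
    and obj: "\<xi> < (\<Sum>j<N. p j * quad nb B b (z j))"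
  defines "\<kappa> \<equiv> 2 * ln (8 * (\<Sum>k\<in>UNIV. real (f k)))"
  obtains y where "\<xi> < quad nb B b y"
    and "\<And>k v. dot (f k) (mv (f k) (lin nb (S k) y) v) (mv (f k) (lin nb (S k) y) v)
             \<le> \<kappa> * \<sigma> k * dot (f k) v v"
proof -
  define F where "F = (\<Sum>k\<in>UNIV. real (f k))"
  have "real (f undefined) \<le> F" unfolding F_def by (intro member_le_sum) auto
  hence F: "1 \<le> F" using f[of undefined] by linarith
  have \<kappa>: "0 < \<kappa>" using F by (simp add: \<kappa>_def F_def[symmetric])
  have exp\<kappa>: "exp (- \<kappa> / 2) = 1 / (8 * F)"
    using F by (simp add: \<kappa>_def F_def[symmetric] exp_minus field_simps)
  define r where "r j = sqrt (p j)" for j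
  have r2: "(r j)\<^sup>2 = p j" if "j < N" for j using p[OF that] by (simp add: r_def)
  define G where "G = (\<lambda>j l. r j * r l * (dot nb (z j) (mv nb B (z l)) + dot nb b (z j) + dot nb b (z l)))"
  have "symm N G"
    unfolding G_def by (rule symm_gram[OF symB])
  then obtain lam u where eig: "eigenbasis N G lam u" by (rule spectral_theorem)
  have on: "orthonormal N u" using eig by (simp add: eigenbasis_def)
  define s where "s i = dot N (u i) r" for i
  define A where "A k i = lin nb (S k) (\<lambda>c. \<Sum>j<N. u i j * r j * z j c)" for k i
  define w where "w E j = (\<Sum>i<N. sg E i * u i j)" for E j
  define Y where "Y E = (\<lambda>c. \<Sum>j<N. w E j * r j * z j c)" for E
  have sE: "(\<Sum>j<N. w E j * r j) = signed_sum s {..<N} E" for E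
    unfolding w_def signed_sum_def s_def dot_def sum_distrib_left sum_distrib_right
    by (subst sum.swap) (simp only: mult.assoc)
  have YE: "Y E = (\<lambda>c. \<Sum>i<N. sg E i * (\<Sum>j<N. u i j * r j * z j c))" for E
    unfolding Y_def w_def sum_distrib_left sum_distrib_right
    by (intro ext, subst sum.swap) (simp only: mult.assoc)
  have linY: "mv (f k) (lin nb (S k) (Y E)) v = mv (f k) (signed_mat N (A k) E) v" for k E v
    unfolding YE mv_lin_sum[of _ _ _ "sg E"] mv_signed_mat A_def ..
  have var': "(\<Sum>i<N. dot (f k) (mv (f k) (A k i) v) (mv (f k) (A k i) v)) \<le> \<sigma> k * dot (f k) v v"
    for k v
    unfolding A_def rotated_variance[OF on] using var[of k v] by (simp add: r2)
  define bad where "bad k E \<longleftrightarrow> (\<exists>v. \<kappa> * \<sigma> k * dot (f k) v v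
      < dot (f k) (mv (f k) (signed_mat N (A k) E) v) (mv (f k) (signed_mat N (A k) E) v))" for k E
  have tail: "(\<Sum>E\<in>Pow {..<N}. of_bool (bad k E) :: real) \<le> 2 ^ N * (2 * real (f k) * (1 / (8 * F)))" for k
    unfolding bad_def exp\<kappa>[symmetric]
    by (rule matrix_khintchine_tail[OF _ \<sigma> \<kappa> var']) (auto simp: A_def intro: symm_lin symS)
  have "(\<Sum>i<N. (s i)\<^sup>2) = dot N r r"
    by (subst parseval[OF on]) (simp add: s_def power2_eq_square)
  also have "\<dots> = (\<Sum>j<N. p j)"
    unfolding dot_def by (intro sum.cong refl) (simp add: r2[symmetric] power2_eq_square)
  finally have small: "2 ^ N / 3 \<le> (\<Sum>E\<in>Pow {..<N}. of_bool (\<bar>signed_sum s {..<N} E\<bar> \<le> 1) :: real)"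
    using signed_sum_anticoncentration[of "{..<N}" s] p1 by simp
  have "\<exists>E. \<bar>signed_sum s {..<N} E\<bar> \<le> 1 \<and> (\<forall>k. \<not> bad k E)"
  proof (rule ccontr)
    assume none: "\<not> ?thesis"
    have "of_bool (\<bar>signed_sum s {..<N} E\<bar> \<le> 1) \<le> (\<Sum>k\<in>UNIV. of_bool (bad k E) :: real)" for E
    proof (cases "\<bar>signed_sum s {..<N} E\<bar> \<le> 1")
      case True
      then obtain k where "bad k E" using none by blast
      hence "of_bool (\<bar>signed_sum s {..<N} E\<bar> \<le> 1) \<le> (of_bool (bad k E) :: real)" by simp
      also have "\<dots> \<le> (\<Sum>k\<in>UNIV. of_bool (bad k E))" by (intro member_le_sum) auto
      finally show ?thesis .
    qed (simp add: sum_nonneg)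
    hence "2 ^ N / 3 \<le> (\<Sum>E\<in>Pow {..<N}. \<Sum>k\<in>UNIV. of_bool (bad k E) :: real)"
      by (intro order_trans[OF small] sum_mono)
    also have "\<dots> = (\<Sum>k\<in>UNIV. \<Sum>E\<in>Pow {..<N}. of_bool (bad k E))" by (rule sum.swap)
    also have "\<dots> \<le> (\<Sum>k\<in>UNIV. 2 ^ N * (2 * real (f k) * (1 / (8 * F))))" by (intro sum_mono tail)
    also have "\<dots> = 2 ^ N * (2 * F * (1 / (8 * F)))"
      by (simp only: F_def sum_distrib_left sum_distrib_right)
    also have "\<dots> = 2 ^ N / 4" using F by simp
    finally show False by simp
  qed
  then obtain E where s1: "\<bar>signed_sum s {..<N} E\<bar> \<le> 1" and good: "\<And>k. \<not> bad k E" by blast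
  define e where "e = (if 0 \<le> dot nb b (Y E) then 1 else - 1 :: real)"
  have e: "e * e = 1" "e * dot nb b (Y E) = \<bar>dot nb b (Y E)\<bar>" by (auto simp: e_def)
  have ee: "e * (e * x) = x" for x using e(1) by (simp add: mult.assoc[symmetric])
  show thesis
  proof (rule that)
    have "\<xi> < (\<Sum>j<N. (r j)\<^sup>2 * quad nb B b (z j))" using obj by (simp add: r2)
    also have "\<dots> = dot nb (Y E) (mv nb B (Y E)) + 2 * (\<Sum>j<N. w E j * r j) * dot nb b (Y E)"
      using quadratic_value_constant_on_signs[OF symB, of N r z b lam u E] eig
      unfolding Y_def w_def G_def by simp
    also have "\<dots> \<le> dot nb (Y E) (mv nb B (Y E)) + 2 * \<bar>dot nb b (Y E)\<bar>"
    proof -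
      have "signed_sum s {..<N} E * dot nb b (Y E) \<le> \<bar>signed_sum s {..<N} E\<bar> * \<bar>dot nb b (Y E)\<bar>"
        by (simp add: abs_mult[symmetric])
      also have "\<dots> \<le> 1 * \<bar>dot nb b (Y E)\<bar>" using s1 by (intro mult_right_mono) auto
      finally show ?thesis by (simp add: sE)
    qed
    also have "\<dots> = quad nb B b (\<lambda>c. e * Y E c)"
      by (simp add: quad_def dot_scale mv_scale ee e(2))
    finally show "\<xi> < quad nb B b (\<lambda>c. e * Y E c)" .
  next
    fix k v
    have "dot (f k) (mv (f k) (lin nb (S k) (\<lambda>c. e * Y E c)) v) (mv (f k) (lin nb (S k) (\<lambda>c. e * Y E c)) v)
        = dot (f k) (mv (f k) (lin nb (S k) (Y E)) v) (mv (f k) (lin nb (S k) (Y E)) v)"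
      unfolding mv_lin_scale dot_scale by (rule ee)
    also have "\<dots> \<le> \<kappa> * \<sigma> k * dot (f k) v v"
      using good[of k] unfolding linY bad_def by (simp add: not_less)
    finally show "dot (f k) (mv (f k) (lin nb (S k) (\<lambda>c. e * Y E c)) v)
        (mv (f k) (lin nb (S k) (\<lambda>c. e * Y E c)) v) \<le> \<kappa> * \<sigma> k * dot (f k) v v" .
  qed
qed

section \<open>Existence of Lagrange multipliers\<close>

text \<open>
By compactness finitely many of the inequalities may be treated at a time. For these, let \<open>x\<close> minimise
the sum of the squares of the violations \<open>p\<^sub>j = max 0 (g\<^sub>j x)\<close>. If a violation were positive, the
optimality of \<open>x\<close> would make \<open>\<Sum>j. p\<^sub>j g\<^sub>j\<close> positive on all of \<open>K\<close>, against the assumption on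
convex combinations. The map \<open>mix\<close> plays the part of
forming convex combinations in \<open>K\<close>.
\<close>

theorem convex_affine_system_solvable:
  fixes K :: "'a::topological_space set" and g :: "'j \<Rightarrow> 'a \<Rightarrow> real"
    and mix :: "real \<Rightarrow> 'a \<Rightarrow> 'a \<Rightarrow> 'a"
  assumes K: "compact K" "K \<noteq> {}" and cont: "\<And>j. continuous_on UNIV (g j)"
    and mixK: "\<And>x y t. x \<in> K \<Longrightarrow> y \<in> K \<Longrightarrow> 0 \<le> t \<Longrightarrow> t \<le> 1 \<Longrightarrow> mix t x y \<in> K"
    and affine: "\<And>x y t j. g j (mix t x y) = (1 - t) * g j x + t * g j y"
    and fin: "\<And>J' p. finite J' \<Longrightarrow> J' \<subseteq> J \<Longrightarrow> (\<And>j. j \<in> J' \<Longrightarrow> 0 \<le> p j) \<Longrightarrow> (\<Sum>j\<in>J'. p j) = 1 \<Longrightarrow>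
           \<exists>x\<in>K. (\<Sum>j\<in>J'. p j * g j x) \<le> 0"
  shows "\<exists>x\<in>K. \<forall>j\<in>J. g j x \<le> 0"
proof -
  have "K \<inter> (\<Inter>j\<in>J. {x. g j x \<le> 0}) \<noteq> {}"
  proof (rule compact_imp_fip_image[OF K(1)])
    show "closed {x. g j x \<le> 0}" for j
      by (intro closed_Collect_le cont continuous_intros)
    fix J' assume J': "finite J'" "J' \<subseteq> J"
    define h where "h x = (\<Sum>j\<in>J'. (max 0 (g j x))\<^sup>2)" for x
    have "continuous_on K (g j)" for j using cont by (rule continuous_on_subset) simp
    hence "continuous_on K h" unfolding h_def by (intro continuous_intros)
    then obtain x where x: "x \<in> K" and min: "\<And>y. y \<in> K \<Longrightarrow> h x \<le> h y"
      using continuous_attains_inf[OF K] by blast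
    define p where "p j = max 0 (g j x)" for j
    have grad: "0 \<le> (\<Sum>j\<in>J'. p j * (g j y - g j x))" if y: "y \<in> K" for y
    proof (rule ccontr)
      define a b where "a = (\<Sum>j\<in>J'. p j * (g j y - g j x))" and "b = (\<Sum>j\<in>J'. (g j y - g j x)\<^sup>2)"
      assume "\<not> ?thesis"
      hence a: "a < 0" by (simp add: a_def)
      have b: "0 \<le> b" by (simp add: b_def sum_nonneg)
      have main: "0 \<le> 2 * a + t * b" if t: "0 < t" "t \<le> 1" for t
      proof -
        have "h x \<le> h (mix t x y)" using x y t by (intro min mixK) auto
        also have "\<dots> \<le> (\<Sum>j\<in>J'. (p j + t * (g j y - g j x))\<^sup>2)"
          unfolding h_def
        proof (rule sum_mono)
          fix j
          have gm: "g j (mix t x y) = g j x + t * (g j y - g j x)"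
            by (simp add: affine algebra_simps)
          show "(max 0 (g j (mix t x y)))\<^sup>2 \<le> (p j + t * (g j y - g j x))\<^sup>2"
          proof (cases "0 \<le> g j (mix t x y)")
            case True
            \<comment> \<open>Replacing \<open>max 0 (a + t d)\<close> by \<open>max 0 a + t d\<close> can only increase the square.\<close>
            have "g j (mix t x y) \<le> p j + t * (g j y - g j x)" by (simp add: gm p_def)
            thus ?thesis using True by (simp add: power_mono)
          qed simp
        qed
        also have "\<dots> = (\<Sum>j\<in>J'. (p j)\<^sup>2 + (2 * t * (p j * (g j y - g j x)) + t\<^sup>2 * (g j y - g j x)\<^sup>2))"
          by (intro sum.cong refl) (simp add: power2_eq_square algebra_simps)
        also have "\<dots> = h x + (2 * t * a + t\<^sup>2 * b)"
          by (simp only: sum.distrib h_def p_def a_def b_def sum_distrib_left)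
        finally have "0 \<le> t * (2 * a + t * b)" by (simp add: power2_eq_square algebra_simps)
        thus ?thesis using t by (simp add: zero_le_mult_iff)
      qed
      \<comment> \<open>A step so small that the linear term dominates the quadratic one.\<close>
      define t where "t = min 1 (- a / (b + 1))"
      have "0 < - a / (b + 1)" using a b by (intro divide_pos_pos) auto
      hence t: "0 < t" "t \<le> 1" by (auto simp: t_def)
      have "t * b \<le> (- a / (b + 1)) * b" using b by (intro mult_right_mono) (auto simp: t_def)
      also have "\<dots> \<le> (- a / (b + 1)) * (b + 1)"
        using \<open>0 < - a / (b + 1)\<close> by (intro mult_left_mono) auto
      also have "\<dots> = - a" using b by simp
      finally show False using main[OF t] a by linarith
    qed
    have "p j = 0" if "j \<in> J'" for j
    proof (rule ccontr)
      assume "p j \<noteq> 0"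
      hence pj: "0 < p j" by (simp add: p_def)
      define P where "P = (\<Sum>j\<in>J'. p j)"
      have p0: "0 \<le> p j" for j by (simp add: p_def)
      have "p j \<le> P" unfolding P_def using that J' p0 by (intro member_le_sum) auto
      hence P: "0 < P" using pj by linarith
      have "(\<Sum>j\<in>J'. p j / P) = 1" using P by (simp add: P_def sum_divide_distrib[symmetric])
      then obtain y where y: "y \<in> K" "(\<Sum>j\<in>J'. p j / P * g j y) \<le> 0"
        using fin[OF J', of "\<lambda>j. p j / P"] p0 P by auto
      have "(\<Sum>j\<in>J'. p j * g j y) = P * (\<Sum>j\<in>J'. p j / P * g j y)"
        using P by (simp add: sum_distrib_left)
      also have "\<dots> \<le> 0" using y(2) P by (simp add: mult_le_0_iff)
      finally have "(\<Sum>j\<in>J'. p j * g j x) \<le> 0"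
        using grad[OF y(1)] by (simp add: right_diff_distrib sum_subtractf)
      moreover have "(p j)\<^sup>2 \<le> (\<Sum>j\<in>J'. p j * g j x)"
      proof -
        have "(p j)\<^sup>2 \<le> (\<Sum>j\<in>J'. (p j)\<^sup>2)" using that J' by (intro member_le_sum) auto
        also have "\<dots> = (\<Sum>j\<in>J'. p j * g j x)"
          by (intro sum.cong refl) (auto simp: p_def power2_eq_square max_def)
        finally show ?thesis .
      qed
      moreover have "0 < (p j)\<^sup>2" using pj by simp
      ultimately show False by linarith
    qed
    hence "g j x \<le> 0" if "j \<in> J'" for j
      using that by (metis max.cobounded2 p_def)
    hence "x \<in> K \<inter> (\<Inter>j\<in>J'. {x. g j x \<le> 0})" using x by blast
    thus "K \<inter> (\<Inter>j\<in>J'. {x. g j x \<le> 0}) \<noteq> {}" by blast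
  qed
  thus ?thesis by blast
qed

definition tr :: "nat \<Rightarrow> (nat \<Rightarrow> nat \<Rightarrow> real) \<Rightarrow> real" where
  "tr m L = (\<Sum>p<m. L p p)"

text \<open>
For symmetric \<open>M\<close> this is \<open>Tr (L * M * M)\<close>.
\<close>

definition tr2 :: "nat \<Rightarrow> (nat \<Rightarrow> nat \<Rightarrow> real) \<Rightarrow> (nat \<Rightarrow> nat \<Rightarrow> real) \<Rightarrow> real" where
  "tr2 m L M = (\<Sum>p<m. \<Sum>q<m. L p q * dot m (M p) (M q))"

definition psd :: "nat \<Rightarrow> (nat \<Rightarrow> nat \<Rightarrow> real) \<Rightarrow> bool" where
  "psd m L \<longleftrightarrow> symm m L \<and> (\<forall>v. 0 \<le> dot m v (mv m L v))"

lemma dot_mv_unit: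
  assumes "p < m" "q < m"
  shows "dot m (\<lambda>i. if i = p then 1 else 0) (mv m L (\<lambda>i. if i = q then 1 else 0)) = L p q"
proof -
  have "mv m L (\<lambda>i. if i = q then 1 else 0) p = dot m (\<lambda>i. if i = q then 1 else 0) (L p)"
    by (simp add: mv_def dot_def mult.commute)
  thus ?thesis using assms by (simp add: dot_unit)
qed

lemma psd_diag_nonneg: "psd m L \<Longrightarrow> p < m \<Longrightarrow> 0 \<le> L p p"
  by (metis dot_mv_unit psd_def)

text \<open>
Testing with \<open>e\<^sub>p + e\<^sub>q\<close> and \<open>e\<^sub>p - e\<^sub>q\<close> bounds \<open>2 * \<bar>L p q\<bar>\<close> by \<open>L p p + L q q\<close>.
\<close>

lemma psd_entry_le_trace:
  assumes "psd m L" "p < m" "q < m"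
  shows "\<bar>L p q\<bar> \<le> tr m L"
proof (cases "p = q")
  case True
  have "L p p \<le> tr m L"
    unfolding tr_def using assms psd_diag_nonneg by (intro member_le_sum) auto
  thus ?thesis using True psd_diag_nonneg[OF assms(1,2)] by simp
next
  case False
  let ?e = "\<lambda>a i. if i = a then 1 else 0 :: real"
  have "0 \<le> L p p + L q q + 2 * s * L p q" if "s * s = 1" for s
  proof -
    have "L q p = L p q" using assms by (auto simp: psd_def symm_def)
    moreover have "0 \<le> dot m (\<lambda>i. 1 * ?e p i + s * ?e q i) (mv m L (\<lambda>i. 1 * ?e p i + s * ?e q i))"
      using assms(1) by (auto simp: psd_def)
    ultimately have "0 \<le> L p p + s * L p q + s * (L p q + s * L q q)"
      unfolding mv_comb2 dot_comb2 using assms(2,3) by (simp add: dot_mv_unit)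
    also have "\<dots> = L p p + 2 * s * L p q + (s * s) * L q q" by (simp add: algebra_simps)
    finally show ?thesis by (simp add: that)
  qed
  from this[of 1] this[of "-1"] have "2 * \<bar>L p q\<bar> \<le> L p p + L q q" by (auto simp: abs_if)
  also have "\<dots> = (\<Sum>a\<in>{p,q}. L a a)" using False by simp
  also have "\<dots> \<le> tr m L"
    unfolding tr_def using assms psd_diag_nonneg by (intro sum_mono2) auto
  finally show ?thesis by simp
qed

lemma tr_nonneg: "psd m L \<Longrightarrow> 0 \<le> tr m L"
  unfolding tr_def by (intro sum_nonneg psd_diag_nonneg) auto

lemma tr2_rank_one:
  assumes "symm m M"
  shows "tr2 m (\<lambda>p q. c * (v p * v q)) M = c * dot m (mv m M v) (mv m M v)"
proof -
  have "mv m M v r = (\<Sum>p<m. v p * M p r)" if "r < m" for r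
    using assms that unfolding mv_def symm_def by (intro sum.cong refl) (simp add: mult.commute)
  hence "dot m (mv m M v) (mv m M v) = dot m (\<lambda>r. \<Sum>p<m. v p * M p r) (\<lambda>r. \<Sum>p<m. v p * M p r)"
    by (intro dot_cong) auto
  also have "\<dots> = (\<Sum>p<m. v p * (\<Sum>q<m. v q * dot m (M p) (M q)))"
    unfolding dot_lin_left dot_lin_right ..
  finally show ?thesis by (simp add: tr2_def sum_distrib_left mult.assoc)
qed

lemma tr2_cong: "(\<And>p q. p < m \<Longrightarrow> q < m \<Longrightarrow> L p q = L' p q) \<Longrightarrow> tr2 m L M = tr2 m L' M"
  unfolding tr2_def by (intro sum.cong refl) auto

lemma continuous_on_eval3 [continuous_intros]:
  fixes S :: "('a \<Rightarrow> 'b \<Rightarrow> 'c \<Rightarrow> 'd::topological_space) set"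
  shows "continuous_on S (\<lambda>u. u a b c)"
  by (rule continuous_on_product_then_coordinatewise[OF
        continuous_on_product_then_coordinatewise[OF
        continuous_on_product_then_coordinatewise[OF continuous_on_id]]])

lemma dot_mv_mix:
  "dot m v (mv m (\<lambda>p q. a * L p q + b * M p q) v) = a * dot m v (mv m L v) + b * dot m v (mv m M v)"
proof -
  have "mv m (\<lambda>p q. a * L p q + b * M p q) v = (\<lambda>i. a * mv m L v i + b * mv m M v i)"
    by (rule ext) (simp add: mv_def sum_distrib_left sum.distrib[symmetric] algebra_simps)
  thus ?thesis by (simp only: dot_comb2)
qed

lemma psd_mix: "psd m L \<Longrightarrow> psd m M \<Longrightarrow> 0 \<le> a \<Longrightarrow> 0 \<le> b \<Longrightarrow> psd m (\<lambda>p q. a * L p q + b * M p q)"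
  unfolding psd_def dot_mv_mix by (auto simp: symm_def intro!: add_nonneg_nonneg mult_nonneg_nonneg)

lemma tr_mix: "tr m (\<lambda>p q. a * L p q + b * M p q) = a * tr m L + b * tr m M"
  by (simp add: tr_def sum.distrib sum_distrib_left)

lemma tr2_mix: "tr2 m (\<lambda>p q. a * L p q + b * M p q) N = a * tr2 m L N + b * tr2 m M N"
  by (simp add: tr2_def sum.distrib sum_distrib_left distrib_right mult.assoc)

lemma psd_rank_one:
  assumes "0 \<le> c" shows "psd m (\<lambda>p q. if p < m \<and> q < m then c * (v p * v q) else 0)"
proof -
  let ?L = "\<lambda>p q. if p < m \<and> q < m then c * (v p * v q) else 0"
  have "dot m x (mv m ?L x) = c * (dot m v x * dot m v x)" for x
  proof -
    have "mv m ?L x i = (c * dot m v x) * v i" if "i < m" for i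
      using that by (simp add: mv_def dot_def sum_distrib_left sum_distrib_right mult_ac)
    hence "dot m x (mv m ?L x) = dot m x (\<lambda>i. (c * dot m v x) * v i)" by (intro dot_cong) auto
    thus ?thesis unfolding dot_scale by (simp add: dot_commute[of m x v])
  qed
  thus ?thesis using assms by (auto simp: psd_def symm_def)
qed

text \<open>
The multipliers are forced to vanish outside their index ranges, since otherwise irrelevant values would
make the set unbounded.
\<close>

lemma compact_psd_trace_bounded:
  fixes f :: "'k::finite \<Rightarrow> nat" and \<beta> :: "'k \<Rightarrow> real"
  assumes \<beta>: "\<And>k. 0 < \<beta> k"
  shows "compact {L. (\<forall>k. psd (f k) (L k)) \<and> (\<forall>k p q. \<not> (p < f k \<and> q < f k) \<longrightarrow> L k p q = 0)
           \<and> (\<Sum>k\<in>UNIV. \<beta> k * tr (f k) (L k)) \<le> C}" (is "compact ?K")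
proof -
  define c where "c k = C / \<beta> k" for k
  have entry: "\<bar>L k p q\<bar> \<le> max 0 (c k)" if L: "L \<in> ?K" for L k p q
  proof (cases "p < f k \<and> q < f k")
    case True
    have "\<beta> k * tr (f k) (L k) \<le> (\<Sum>k\<in>UNIV. \<beta> k * tr (f k) (L k))"
    proof (intro member_le_sum)
      show "0 \<le> \<beta> k' * tr (f k') (L k')" for k'
        using L \<beta>[of k'] by (simp add: tr_nonneg less_imp_le)
    qed auto
    also have "\<dots> \<le> C" using L by simp
    finally have "tr (f k) (L k) \<le> c k" using \<beta>[of k] by (simp add: c_def field_simps)
    moreover have "\<bar>L k p q\<bar> \<le> tr (f k) (L k)" using L True by (intro psd_entry_le_trace) auto
    ultimately show ?thesis by simp
  next
    case False
    thus ?thesis using L by auto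
  qed
  define Box :: "('k \<Rightarrow> nat \<Rightarrow> nat \<Rightarrow> real) set"
    where "Box = {L. \<forall>k. L k \<in> {M. \<forall>p. M p \<in> {v. \<forall>q. v q \<in> {- max 0 (c k)..max 0 (c k)}}}}"
  have "compact Box" unfolding Box_def by (intro compact_fun_box) simp
  moreover have "closed ?K"
  proof -
    have eq: "?K = (\<Inter>k. \<Inter>p\<in>{..<f k}. \<Inter>q\<in>{..<f k}. {L. L k p q = L k q p}) \<inter>
        (\<Inter>k. \<Inter>v. {L. 0 \<le> dot (f k) v (mv (f k) (L k) v)}) \<inter>
        (\<Inter>k. \<Inter>(p, q)\<in>-({..<f k} \<times> {..<f k}). {L. L k p q = 0}) \<inter>
        {L. (\<Sum>k\<in>UNIV. \<beta> k * tr (f k) (L k)) \<le> C}"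
      unfolding psd_def symm_def by (auto; blast)
    have c1: "closed {L::'k\<Rightarrow>nat\<Rightarrow>nat\<Rightarrow>real. L k p q = L k q p}" for k p q
      by (intro closed_Collect_eq continuous_intros)
    have c2: "closed {L::'k\<Rightarrow>nat\<Rightarrow>nat\<Rightarrow>real. 0 \<le> dot (f k) v (mv (f k) (L k) v)}" for k v
      unfolding dot_def mv_def by (intro closed_Collect_le continuous_intros)
    have c3: "closed {L::'k\<Rightarrow>nat\<Rightarrow>nat\<Rightarrow>real. L k p q = 0}" for k p q
      by (intro closed_Collect_eq continuous_intros)
    have c4: "closed {L::'k\<Rightarrow>nat\<Rightarrow>nat\<Rightarrow>real. (\<Sum>k\<in>UNIV. \<beta> k * tr (f k) (L k)) \<le> C}"
      unfolding tr_def by (intro closed_Collect_le continuous_intros)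
    show ?thesis unfolding eq
      by (intro closed_Int closed_INT ballI c1 c2 c4) (auto intro: c3)
  qed
  moreover have "?K \<subseteq> Box"
  proof
    fix L assume "L \<in> ?K"
    hence "\<bar>L k p q\<bar> \<le> max 0 (c k)" for k p q by (rule entry)
    thus "L \<in> Box" unfolding Box_def by (simp add: abs_le_iff minus_le_iff)
  qed
  ultimately show ?thesis using compact_Int_closed[of Box ?K] by (simp add: Int_absorb1)
qed

text \<open>
This is strong duality with attainment. The assumption \<open>bound\<close> says that the relaxed problem over
distributions of points has value at most \<open>\<xi>\<close>; the point \<open>tb\<close> of \<open>T\<close> is a Slater point.

For \<open>q 0 = 0\<close>, evaluating the desired inequalities at \<open>z = 0\<close> and \<open>t = tb\<close> bounds the traces of the multipliers,
so it is natural to look for them in the compact set \<open>K\<close>. If there were none, some convex combination of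
the inequalities, that is a distribution \<open>p\<close> of points with objective \<open>Q\<close> and a mean \<open>th\<close> of elements of
\<open>T\<close>, would be violated on all of \<open>K\<close>. The zero multiplier shows \<open>Q > \<xi>\<close>. Multipliers of rank one show
that \<open>p\<close> violates the constraints for \<open>th\<close> by at most \<open>\<mu> \<rho> tb\<^sub>k I\<close>. After mixing \<open>th\<close>
with \<open>tb\<close>, the scaled weights \<open>p / (1 + \<mu>)\<close> of total mass below \<open>1\<close> are therefore feasible, and their objective still exceeds \<open>\<xi>\<close>.
\<close>

theorem lagrange_multipliers_exist:
  fixes f :: "'k::finite \<Rightarrow> nat" and S :: "'k \<Rightarrow> nat \<Rightarrow> nat \<Rightarrow> nat \<Rightarrow> real"
    and q :: "(nat \<Rightarrow> real) \<Rightarrow> real" and T :: "(real ^ 'k) set"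
  assumes symS: "\<And>k i. i < nb \<Longrightarrow> symm (f k) (S k i)"
    and T: "convex T" and tb: "tb \<in> T" "\<And>k. 0 < vec_nth tb k" and \<rho>: "0 < \<rho>"
    and bound: "\<And>N p z t. (\<And>j. j < N \<Longrightarrow> 0 \<le> p j) \<Longrightarrow> (\<Sum>j<N. p j) \<le> 1 \<Longrightarrow> t \<in> T \<Longrightarrow>
        (\<And>k v. (\<Sum>j<(N::nat). p j * dot (f k) (mv (f k) (lin nb (S k) (z j)) v)
             (mv (f k) (lin nb (S k) (z j)) v)) \<le> \<rho> * vec_nth t k * dot (f k) v v) \<Longrightarrow>
        (\<Sum>j<N. p j * q (z j)) \<le> \<xi>"
  obtains L where "\<And>k. psd (f k) (L k)"
    and "\<And>z t. t \<in> T \<Longrightarrow> q z + \<rho> * (\<Sum>k\<in>UNIV. vec_nth t k * tr (f k) (L k))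
           \<le> \<xi> + (\<Sum>k\<in>UNIV. tr2 (f k) (L k) (lin nb (S k) z))"
proof -
  have \<xi>: "0 \<le> \<xi>"
  proof -
    have "0 \<le> \<rho> * vec_nth tb k * dot (f k) v v" for k v
      using \<rho> tb(2)[of k] by (intro mult_nonneg_nonneg dot_self_nonneg) auto
    thus ?thesis using bound[of 0 "\<lambda>_. 0" tb "\<lambda>_ _. 0"] tb(1) by simp
  qed
  \<comment> \<open>The bound \<open>\<xi> + 1\<close> instead of \<open>\<xi>\<close> makes the final comparison strict, also for \<open>\<xi> = 0\<close>.\<close>
  define K where "K = {L. (\<forall>k. psd (f k) (L k)) \<and> (\<forall>k p q. \<not> (p < f k \<and> q < f k) \<longrightarrow> L k p q = 0)
           \<and> (\<Sum>k\<in>UNIV. (\<rho> * vec_nth tb k) * tr (f k) (L k)) \<le> \<xi> + 1}"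
  define g where "g j L = q (fst j) - \<xi> + \<rho> * (\<Sum>k\<in>UNIV. vec_nth (snd j) k * tr (f k) (L k))
      - (\<Sum>k\<in>UNIV. tr2 (f k) (L k) (lin nb (S k) (fst j)))"
    for j :: "(nat \<Rightarrow> real) \<times> (real ^ 'k)" and L :: "'k \<Rightarrow> nat \<Rightarrow> nat \<Rightarrow> real"
  have zeroK: "(\<lambda>_ _ _. 0) \<in> K"
    using \<xi> by (auto simp: K_def psd_def symm_def tr_def dot_def mv_def)
  have "\<exists>L\<in>K. \<forall>j\<in>UNIV \<times> T. g j L \<le> 0"
  proof (rule convex_affine_system_solvable[where mix = "\<lambda>s x y k p q. (1 - s) * x k p q + s * y k p q"])
    show "compact K" unfolding K_def using \<rho> tb(2) by (intro compact_psd_trace_bounded) simp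
    show "K \<noteq> {}" using zeroK by blast
    show "continuous_on UNIV (g j)" for j
      unfolding g_def tr_def tr2_def by (intro continuous_intros)
    fix x y :: "'k \<Rightarrow> nat \<Rightarrow> nat \<Rightarrow> real" and s :: real
    show "g j (\<lambda>k p q. (1 - s) * x k p q + s * y k p q) = (1 - s) * g j x + s * g j y" for j
    proof -
      have e1: "(\<Sum>k\<in>UNIV. vec_nth (snd j) k * ((1 - s) * tr (f k) (x k) + s * tr (f k) (y k)))
          = (1 - s) * (\<Sum>k\<in>UNIV. vec_nth (snd j) k * tr (f k) (x k))
            + s * (\<Sum>k\<in>UNIV. vec_nth (snd j) k * tr (f k) (y k))"
        unfolding sum_distrib_left sum.distrib[symmetric]
        by (intro sum.cong refl) (simp add: algebra_simps)
      have e2: "(\<Sum>k\<in>UNIV. (1 - s) * tr2 (f k) (x k) (lin nb (S k) (fst j))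
              + s * tr2 (f k) (y k) (lin nb (S k) (fst j)))
          = (1 - s) * (\<Sum>k\<in>UNIV. tr2 (f k) (x k) (lin nb (S k) (fst j)))
            + s * (\<Sum>k\<in>UNIV. tr2 (f k) (y k) (lin nb (S k) (fst j)))"
        by (simp only: sum_distrib_left sum.distrib)
      show ?thesis
        unfolding g_def tr_mix tr2_mix e1 e2 by (simp add: algebra_simps)
    qed
    assume xy: "x \<in> K" "y \<in> K" and s: "0 \<le> s" "s \<le> 1"
    have "(\<Sum>k\<in>UNIV. (\<rho> * vec_nth tb k) * tr (f k) (\<lambda>p q. (1 - s) * x k p q + s * y k p q))
        = (1 - s) * (\<Sum>k\<in>UNIV. (\<rho> * vec_nth tb k) * tr (f k) (x k))
          + s * (\<Sum>k\<in>UNIV. (\<rho> * vec_nth tb k) * tr (f k) (y k))"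
      unfolding tr_mix sum_distrib_left sum.distrib[symmetric]
      by (intro sum.cong refl) (simp add: algebra_simps)
    also have "\<dots> \<le> (1 - s) * (\<xi> + 1) + s * (\<xi> + 1)"
      using xy s by (intro add_mono mult_left_mono) (auto simp: K_def)
    also have "\<dots> = \<xi> + 1" by (simp add: algebra_simps)
    finally show "(\<lambda>k p q. (1 - s) * x k p q + s * y k p q) \<in> K"
      using xy s by (auto simp: K_def intro!: psd_mix)
  next
    fix J' and p :: "(nat \<Rightarrow> real) \<times> (real ^ 'k) \<Rightarrow> real"
    assume J': "finite J'" "J' \<subseteq> UNIV \<times> T" and p0: "\<And>j. j \<in> J' \<Longrightarrow> 0 \<le> p j" and p1: "(\<Sum>j\<in>J'. p j) = 1"
    show "\<exists>L\<in>K. (\<Sum>j\<in>J'. p j * g j L) \<le> 0"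
    proof (rule ccontr)
      assume "\<not> ?thesis"
      hence pos: "\<And>L. L \<in> K \<Longrightarrow> 0 < (\<Sum>j\<in>J'. p j * g j L)" by force
      define th where "th = (\<Sum>j\<in>J'. p j *\<^sub>R snd j)"
      define Q where "Q = (\<Sum>j\<in>J'. p j * q (fst j))"
      have th: "th \<in> T" unfolding th_def using J' p0 p1 T by (intro convex_sum) auto
      have thk: "vec_nth th k = (\<Sum>j\<in>J'. p j * vec_nth (snd j) k)" for k
        by (simp add: th_def)
      have G: "(\<Sum>j\<in>J'. p j * g j L) = Q - \<xi> + \<rho> * (\<Sum>k\<in>UNIV. vec_nth th k * tr (f k) (L k))
          - (\<Sum>k\<in>UNIV. \<Sum>j\<in>J'. p j * tr2 (f k) (L k) (lin nb (S k) (fst j)))" for L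
      proof -
        have "(\<Sum>j\<in>J'. p j * g j L) = Q - (\<Sum>j\<in>J'. p j) * \<xi>
          + \<rho> * (\<Sum>j\<in>J'. \<Sum>k\<in>UNIV. p j * (vec_nth (snd j) k * tr (f k) (L k)))
          - (\<Sum>j\<in>J'. \<Sum>k\<in>UNIV. p j * tr2 (f k) (L k) (lin nb (S k) (fst j)))"
          by (simp add: g_def Q_def right_diff_distrib distrib_left sum.distrib sum_subtractf
              sum_distrib_left sum_distrib_right mult.left_commute)
        also have "(\<Sum>j\<in>J'. \<Sum>k\<in>UNIV. p j * (vec_nth (snd j) k * tr (f k) (L k)))
            = (\<Sum>k\<in>UNIV. vec_nth th k * tr (f k) (L k))"
          unfolding thk sum_distrib_right by (subst sum.swap) (simp add: mult.assoc)
        also have "(\<Sum>j\<in>J'. \<Sum>k\<in>UNIV. p j * tr2 (f k) (L k) (lin nb (S k) (fst j)))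
            = (\<Sum>k\<in>UNIV. \<Sum>j\<in>J'. p j * tr2 (f k) (L k) (lin nb (S k) (fst j)))"
          by (rule sum.swap)
        finally show ?thesis using p1 by simp
      qed
      have Q: "\<xi> < Q" using pos[OF zeroK] unfolding G by (simp add: tr_def tr2_def)
      define \<mu> where "\<mu> = (Q - \<xi>) / (\<xi> + 1)"
      have \<mu>: "0 < \<mu>" using Q \<xi> by (simp add: \<mu>_def)
      have key: "(\<Sum>j\<in>J'. p j * dot (f k) (mv (f k) (lin nb (S k) (fst j)) v) (mv (f k) (lin nb (S k) (fst j)) v))
          \<le> \<rho> * (vec_nth th k + \<mu> * vec_nth tb k) * dot (f k) v v" for k v
      proof (cases "dot (f k) v v = 0")
        case True
        have "v i * v i = 0" if "i < f k" for i
          using True that unfolding dot_def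
          by (intro sum_nonneg_0[of "{..<f k}" "\<lambda>i. v i * v i" i]) auto
        hence "mv (f k) M v = (\<lambda>_. 0)" for M by (simp add: mv_def)
        thus ?thesis using True by (simp add: dot_def[of _ "\<lambda>_. 0"])
      next
        case False
        hence d: "0 < dot (f k) v v" using dot_self_nonneg[of "f k" v] by linarith
        have rt: "0 < \<rho> * vec_nth tb k" using \<rho> tb(2) by simp
        \<comment> \<open>The largest multiple of the rank one matrix given by \<open>v\<close> that lies in \<open>K\<close>.\<close>
        define c where "c = (\<xi> + 1) / (\<rho> * vec_nth tb k * dot (f k) v v)"
        have c: "0 < c" unfolding c_def using \<xi> by (intro divide_pos_pos[OF _ mult_pos_pos[OF rt d]]) simp
        define R where "R = (\<lambda>p q. if p < f k \<and> q < f k then c * (v p * v q) else 0)"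
        define L where "L = (\<lambda>k'. if k' = k then R else (\<lambda>_ _. 0))"
        have trR: "tr (f k) R = c * dot (f k) v v"
          by (simp add: tr_def R_def dot_def sum_distrib_left)
        have tr2R: "tr2 (f k) R (lin nb (S k) z)
            = c * dot (f k) (mv (f k) (lin nb (S k) z) v) (mv (f k) (lin nb (S k) z) v)" for z
          by (subst tr2_rank_one[symmetric]) (auto intro: symm_lin symS tr2_cong simp: R_def)
        have trL: "(\<Sum>k'\<in>UNIV. a k' * tr (f k') (L k')) = a k * (c * dot (f k) v v)" for a
        proof -
          have "(\<Sum>k'\<in>UNIV. a k' * tr (f k') (L k')) = (\<Sum>k'\<in>UNIV. if k' = k then a k' * tr (f k') R else 0)"
            by (intro sum.cong refl) (simp add: L_def tr_def)
          thus ?thesis by (simp add: trR)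
        qed
        have tr2L: "(\<Sum>k'\<in>UNIV. \<Sum>j\<in>J'. p j * tr2 (f k') (L k') (lin nb (S k') (fst j)))
          = c * (\<Sum>j\<in>J'. p j * dot (f k) (mv (f k) (lin nb (S k) (fst j)) v) (mv (f k) (lin nb (S k) (fst j)) v))"
        proof -
          have "(\<Sum>k'\<in>UNIV. \<Sum>j\<in>J'. p j * tr2 (f k') (L k') (lin nb (S k') (fst j)))
            = (\<Sum>k'\<in>UNIV. if k' = k then \<Sum>j\<in>J'. p j * tr2 (f k') R (lin nb (S k') (fst j)) else 0)"
            by (intro sum.cong refl) (simp add: L_def tr2_def)
          thus ?thesis by (simp add: tr2R sum_distrib_left mult.left_commute)
        qed
        have cd: "\<rho> * vec_nth tb k * (c * dot (f k) v v) = \<xi> + 1"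
          using \<rho> tb(2)[of k] d by (simp add: c_def)
        have "L \<in> K"
        proof -
          have "psd (f k') (L k')" for k'
            using psd_rank_one[of c "f k" v] c by (auto simp: L_def R_def psd_def symm_def dot_def mv_def)
          moreover have "(\<Sum>k'\<in>UNIV. (\<rho> * vec_nth tb k') * tr (f k') (L k')) \<le> \<xi> + 1"
            unfolding trL by (simp only: cd)
          ultimately show ?thesis by (auto simp: K_def L_def R_def)
        qed
        from pos[OF this] have "c * (\<Sum>j\<in>J'. p j * dot (f k) (mv (f k) (lin nb (S k) (fst j)) v)
             (mv (f k) (lin nb (S k) (fst j)) v)) < (Q - \<xi>) + \<rho> * (vec_nth th k * (c * dot (f k) v v))"
          unfolding G trL tr2L by simp
        also have "Q - \<xi> = \<mu> * (\<rho> * vec_nth tb k * (c * dot (f k) v v))"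
          unfolding cd \<mu>_def using \<xi> by simp
        also have "\<mu> * (\<rho> * vec_nth tb k * (c * dot (f k) v v)) + \<rho> * (vec_nth th k * (c * dot (f k) v v))
            = c * (\<rho> * (vec_nth th k + \<mu> * vec_nth tb k) * dot (f k) v v)"
          by (simp add: algebra_simps)
        finally show ?thesis using c by simp
      qed
      \<comment> \<open>The violation \<open>\<mu> * tb\<close> is absorbed by averaging \<open>th\<close> and \<open>tb\<close> with weights \<open>1\<close> and \<open>\<mu>\<close>.\<close>
      define t where "t = (1 / (1 + \<mu>)) *\<^sub>R th + (\<mu> / (1 + \<mu>)) *\<^sub>R tb"
      have t: "t \<in> T" unfolding t_def using T th tb(1) \<mu>
        by (intro convexD) (auto simp: add_divide_distrib[symmetric])
      have tk: "vec_nth t k = (vec_nth th k + \<mu> * vec_nth tb k) / (1 + \<mu>)" for k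
        by (simp add: t_def add_divide_distrib)
      obtain h where h: "bij_betw h {0..<card J'} J'" using ex_bij_betw_nat_finite[OF J'(1)] by blast
      hence h': "bij_betw h {..<card J'} J'" by (simp add: atLeast0LessThan)
      have re: "(\<Sum>j<card J'. F (h j)) = (\<Sum>j\<in>J'. F j)" for F :: "_ \<Rightarrow> real"
        by (rule sum.reindex_bij_betw[OF h'])
      have "(\<Sum>j<card J'. p (h j) / (1 + \<mu>) * q (fst (h j))) \<le> \<xi>"
      proof (rule bound[OF _ _ t])
        show "0 \<le> p (h j) / (1 + \<mu>)" if "j < card J'" for j
          using p0 \<mu> bij_betwE[OF h'] that by auto
        have "(\<Sum>j<card J'. p (h j) / (1 + \<mu>)) = 1 / (1 + \<mu>)"
          using re[of "\<lambda>j. p j / (1 + \<mu>)"] by (simp add: sum_divide_distrib[symmetric] p1)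
        thus "(\<Sum>j<card J'. p (h j) / (1 + \<mu>)) \<le> 1" using \<mu> by simp
        fix k v
        have "(\<Sum>j<card J'. p (h j) / (1 + \<mu>) * dot (f k) (mv (f k) (lin nb (S k) (fst (h j))) v)
               (mv (f k) (lin nb (S k) (fst (h j))) v))
            = (\<Sum>j\<in>J'. p j * dot (f k) (mv (f k) (lin nb (S k) (fst j)) v)
               (mv (f k) (lin nb (S k) (fst j)) v)) / (1 + \<mu>)"
          using re[of "\<lambda>j. p j / (1 + \<mu>) * dot (f k) (mv (f k) (lin nb (S k) (fst j)) v)
               (mv (f k) (lin nb (S k) (fst j)) v)"]
          by (simp only: sum_divide_distrib times_divide_eq_left)
        also have "\<dots> \<le> \<rho> * (vec_nth th k + \<mu> * vec_nth tb k) * dot (f k) v v / (1 + \<mu>)"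
          using \<mu> by (intro divide_right_mono key) auto
        also have "\<dots> = \<rho> * vec_nth t k * dot (f k) v v" by (simp add: tk)
        finally show "(\<Sum>j<card J'. p (h j) / (1 + \<mu>) * dot (f k) (mv (f k) (lin nb (S k) (fst (h j))) v)
               (mv (f k) (lin nb (S k) (fst (h j))) v)) \<le> \<rho> * vec_nth t k * dot (f k) v v" .
      qed
      moreover have "(\<Sum>j<card J'. p (h j) / (1 + \<mu>) * q (fst (h j))) = Q / (1 + \<mu>)"
        using re[of "\<lambda>j. p j / (1 + \<mu>) * q (fst j)"]
        by (simp only: Q_def sum_divide_distrib times_divide_eq_left)
      ultimately have "Q / (1 + \<mu>) \<le> \<xi>" by simp
      hence "Q \<le> \<xi> * (1 + \<mu>)" using \<mu> by (simp add: pos_divide_le_eq)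
      hence "Q - \<xi> \<le> \<mu> * \<xi>" by (simp add: algebra_simps)
      moreover have "Q - \<xi> = \<mu> * (\<xi> + 1)" using \<xi> by (simp add: \<mu>_def)
      ultimately show False using \<mu> by (simp add: algebra_simps)
    qed
  qed
  then obtain L where "L \<in> K" and L: "\<And>z t. t \<in> T \<Longrightarrow> g (z, t) L \<le> 0" by blast
  show thesis
  proof (rule that)
    show "psd (f k) (L k)" for k using \<open>L \<in> K\<close> by (simp add: K_def)
    show "q z + \<rho> * (\<Sum>k\<in>UNIV. vec_nth t k * tr (f k) (L k))
           \<le> \<xi> + (\<Sum>k\<in>UNIV. tr2 (f k) (L k) (lin nb (S k) z))" if "t \<in> T" for z t
      using L[OF that, of z] by (simp add: g_def)
  qed
qed

section \<open>Positive semidefinite and bordered matrices\<close>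

text \<open>
With a spectral decomposition of \<open>L\<close> the left-hand side becomes a combination of the numbers
\<open><M u\<^sub>a, M u\<^sub>a>\<close> with nonnegative weights.
\<close>

lemma tr2_le_trace:
  assumes L: "psd m L" and M: "symm m M"
    and le: "\<And>v. dot m (mv m M v) (mv m M v) \<le> c * dot m v v"
  shows "tr2 m L M \<le> c * tr m L"
proof -
  have symL: "symm m L" using L by (simp add: psd_def)
  then obtain lam u where eig: "eigenbasis m L lam u" by (rule spectral_theorem)
  have on: "orthonormal m u" using eig by (simp add: eigenbasis_def)
  have one: "dot m (u a) (u a) = 1" if "a < m" for a using on that by (simp add: orthonormal_def)
  have lam: "0 \<le> lam a" if "a < m" for a
  proof -
    have "0 \<le> dot m (u a) (mv m L (u a))" using L by (simp add: psd_def)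
    thus ?thesis using that by (simp add: dot_mv_eigen[OF eig] one)
  qed
  have "L p q = (\<Sum>a<m. lam a * (u a p * u a q))" if "p < m" "q < m" for p q
  proof -
    have "L p q = (\<Sum>a<m. dot m (u a) (\<lambda>i. if i = p then 1 else 0)
        * dot m (u a) (mv m L (\<lambda>i. if i = q then 1 else 0)))"
      by (subst dot_mv_unit[OF that, of L, symmetric]) (rule parseval[OF on])
    also have "\<dots> = (\<Sum>a<m. lam a * (u a p * u a q))"
      using that by (intro sum.cong refl)
        (simp add: eigenbasis_dot_mv[OF symL eig] dot_unit_right)
    finally show ?thesis .
  qed
  hence "tr2 m L M = tr2 m (\<lambda>p q. \<Sum>a<m. lam a * (u a p * u a q)) M" by (rule tr2_cong)
  also have "\<dots> = (\<Sum>p<m. \<Sum>q<m. \<Sum>a<m. lam a * (u a p * u a q) * dot m (M p) (M q))"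
    by (simp only: tr2_def sum_distrib_right)
  also have "\<dots> = (\<Sum>p<m. \<Sum>a<m. \<Sum>q<m. lam a * (u a p * u a q) * dot m (M p) (M q))"
    by (intro sum.cong refl sum.swap)
  also have "\<dots> = (\<Sum>a<m. tr2 m (\<lambda>p q. lam a * (u a p * u a q)) M)"
    unfolding tr2_def by (rule sum.swap)
  also have "\<dots> = (\<Sum>a<m. lam a * dot m (mv m M (u a)) (mv m M (u a)))"
    by (simp only: tr2_rank_one[OF M])
  also have "\<dots> \<le> (\<Sum>a<m. lam a * (c * dot m (u a) (u a)))"
    by (intro sum_mono mult_left_mono le lam) auto
  also have "\<dots> = c * tr m L"
    by (simp add: one tr_def eigenvalue_sum[OF eig, symmetric] sum_distrib_left mult.commute)
  finally show ?thesis .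
qed

lemma bordered_form:
  assumes "\<And>i j. i < n \<Longrightarrow> j < n \<Longrightarrow> M i j = D i j"
    and "\<And>i. i < n \<Longrightarrow> M i n = - b i" and "\<And>j. j < n \<Longrightarrow> M n j = - b j" and "M n n = \<tau>"
  shows "dot (n + 1) v (mv (n + 1) M v)
       = dot n v (mv n D v) - 2 * v n * dot n b v + \<tau> * (v n)\<^sup>2"
proof -
  define w where "w = mv (n + 1) M v"
  have "w i = 1 * mv n D v i + (- v n) * b i" if "i < n" for i
    using assms that by (simp add: w_def mv_def)
  hence "dot n v w = dot n v (\<lambda>i. 1 * mv n D v i + (- v n) * b i)" by (intro dot_cong) auto
  also have "\<dots> = dot n v (mv n D v) - v n * dot n b v"
    unfolding dot_comb2 by (simp add: dot_commute[of n v b])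
  finally have e1: "dot n v w = dot n v (mv n D v) - v n * dot n b v" .
  have e2: "w n = - dot n b v + \<tau> * v n"
    using assms by (simp add: w_def mv_def dot_def sum_negf)
  have e3: "dot (n + 1) v w = dot n v w + v n * w n" by (simp add: dot_def)
  show ?thesis unfolding w_def[symmetric] e3 e1 e2 by (simp add: power2_eq_square algebra_simps)
qed

lemma quadratic_nonneg_imp_leading_nonneg:
  fixes a \<beta> \<tau> :: real
  assumes "\<And>s. s \<noteq> 0 \<Longrightarrow> 0 \<le> a - 2 * s * \<beta> + \<tau> * s\<^sup>2"
  shows "0 \<le> a"
proof -
  have "((\<lambda>s. a - 2 * s * \<beta> + \<tau> * s\<^sup>2) \<longlongrightarrow> a - 2 * 0 * \<beta> + \<tau> * 0\<^sup>2) (at_right 0)"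
    by (intro tendsto_intros)
  moreover have "eventually (\<lambda>s. 0 \<le> a - 2 * s * \<beta> + \<tau> * s\<^sup>2) (at_right (0::real))"
    by (rule eventually_at_rightI[of 0 1]) (use assms in auto)
  ultimately have "0 \<le> a - 2 * 0 * \<beta> + \<tau> * 0\<^sup>2"
    by (intro tendsto_lowerbound[where F = "at_right (0::real)"]) auto
  thus ?thesis by simp
qed

text \<open>
The condition on the right is nonnegativity of the form of \<open>M\<close> at the vectors \<open>(z, 1)\<close>. By homogeneity it
extends to all vectors with nonzero last entry, and by continuity to the others.
\<close>

lemma bordered_psd_iff:
  assumes M: "\<And>i j. i < n \<Longrightarrow> j < n \<Longrightarrow> M i j = D i j"
    "\<And>i. i < n \<Longrightarrow> M i n = - b i" "\<And>j. j < n \<Longrightarrow> M n j = - b j" "M n n = \<tau>"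
    and D: "symm n D"
  shows "psd (n + 1) M \<longleftrightarrow> (\<forall>z. 2 * dot n b z - dot n z (mv n D z) \<le> \<tau>)"
proof -
  note form = bordered_form[of n M D b \<tau>, OF M]
  have "symm (n + 1) M"
    using M D unfolding symm_def by (auto simp: less_Suc_eq)
  hence "psd (n + 1) M \<longleftrightarrow> (\<forall>v. 0 \<le> dot n v (mv n D v) - 2 * v n * dot n b v + \<tau> * (v n)\<^sup>2)"
    by (simp only: psd_def form simp_thms)
  also have "\<dots> \<longleftrightarrow> (\<forall>z. 2 * dot n b z - dot n z (mv n D z) \<le> \<tau>)"
  proof (intro iffI allI)
    fix z :: "nat \<Rightarrow> real" assume h: "\<forall>v. 0 \<le> dot n v (mv n D v) - 2 * v n * dot n b v + \<tau> * (v n)\<^sup>2"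
    define v where "v = z(n := 1)"
    have "dot n v y = dot n z y" "dot n y v = dot n y z" "mv n D v = mv n D z" for y
      by (simp_all add: v_def dot_def mv_def)
    thus "2 * dot n b z - dot n z (mv n D z) \<le> \<tau>" using h[rule_format, of v] by (simp add: v_def)
  next
    fix v :: "nat \<Rightarrow> real" assume h: "\<forall>z. 2 * dot n b z - dot n z (mv n D z) \<le> \<tau>"
    have main: "0 \<le> dot n v (mv n D v) - 2 * s * dot n b v + \<tau> * s\<^sup>2" if "s \<noteq> 0" for s
    proof -
      have "2 * ((1/s) * dot n b v) - (1/s) * ((1/s) * dot n v (mv n D v)) \<le> \<tau>"
        using h[rule_format, of "\<lambda>i. (1/s) * v i"] unfolding mv_scale dot_scale .
      hence "s\<^sup>2 * (2 * ((1/s) * dot n b v) - (1/s) * ((1/s) * dot n v (mv n D v))) \<le> s\<^sup>2 * \<tau>"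
        by (rule mult_left_mono) simp
      also have "s\<^sup>2 * (2 * ((1/s) * dot n b v) - (1/s) * ((1/s) * dot n v (mv n D v)))
          = 2 * s * dot n b v - dot n v (mv n D v)"
        using that by (simp add: power2_eq_square right_diff_distrib)
      finally show ?thesis by (simp add: mult.commute)
    qed
    show "0 \<le> dot n v (mv n D v) - 2 * v n * dot n b v + \<tau> * (v n)\<^sup>2"
    proof (cases "v n = 0")
      case True
      thus ?thesis using quadratic_nonneg_imp_leading_nonneg[OF main] by simp
    qed (rule main)
  qed
  finally show ?thesis .
qed

section \<open>Translation of the matrix notions\<close>

definition ent :: "real mat \<Rightarrow> nat \<Rightarrow> nat \<Rightarrow> real" where
  "ent A = (\<lambda>i j. A $$ (i, j))"

lemma scalar_prod_dot: "w \<in> carrier_vec m \<Longrightarrow> v \<bullet> w = dot m (($) v) (($) w)"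
  by (simp add: scalar_prod_def dot_def atLeast0LessThan)

lemma mult_mat_vec_mv:
  "A \<in> carrier_mat m m \<Longrightarrow> v \<in> carrier_vec m \<Longrightarrow> i < m \<Longrightarrow> (A *\<^sub>v v) $ i = mv m (ent A) (($) v) i"
  by (simp add: scalar_prod_def mv_def ent_def atLeast0LessThan)

lemma sym_mats_iff: "A \<in> sym_mats m \<longleftrightarrow> A \<in> carrier_mat m m \<and> symm m (ent A)"
proof (cases "A \<in> carrier_mat m m")
  case True
  have "transpose_mat A = A \<longleftrightarrow> symm m (ent A)"
  proof
    assume tA: "transpose_mat A = A"
    show "symm m (ent A)" unfolding symm_def ent_def
    proof (intro allI impI)
      fix i j assume "i < m" "j < m"
      hence "transpose_mat A $$ (i, j) = A $$ (j, i)" using True by simp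
      thus "A $$ (i, j) = A $$ (j, i)" by (simp add: tA)
    qed
  next
    assume "symm m (ent A)"
    thus "transpose_mat A = A" using True by (intro eq_matI) (auto simp: symm_def ent_def)
  qed
  thus ?thesis using True by (simp add: sym_mats_def)
qed (simp add: sym_mats_def)

lemma quadratic_form_dot:
  assumes "A \<in> carrier_mat m m" "v \<in> carrier_vec m"
  shows "v \<bullet> (A *\<^sub>v v) = dot m (($) v) (mv m (ent A) (($) v))"
proof -
  have "v \<bullet> (A *\<^sub>v v) = dot m (($) v) (($) (A *\<^sub>v v))"
    using assms by (intro scalar_prod_dot) simp
  also have "\<dots> = dot m (($) v) (mv m (ent A) (($) v))"
    using assms by (intro dot_cong refl mult_mat_vec_mv)
  finally show ?thesis .
qed

lemma psd_mats_iff: "A \<in> psd_mats m \<longleftrightarrow> A \<in> carrier_mat m m \<and> psd m (ent A)"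
proof (cases "A \<in> carrier_mat m m")
  case True
  have "(\<forall>v\<in>carrier_vec m. 0 \<le> v \<bullet> (A *\<^sub>v v)) \<longleftrightarrow> (\<forall>v. 0 \<le> dot m v (mv m (ent A) v))"
  proof (intro iffI allI ballI)
    fix v :: "nat \<Rightarrow> real"
    assume "\<forall>v\<in>carrier_vec m. 0 \<le> v \<bullet> (A *\<^sub>v v)"
    hence "0 \<le> Matrix.vec m v \<bullet> (A *\<^sub>v Matrix.vec m v)" by simp
    hence "0 \<le> dot m (($) (Matrix.vec m v)) (mv m (ent A) (($) (Matrix.vec m v)))"
      by (simp only: quadratic_form_dot[OF True vec_carrier])
    also have "\<dots> = dot m v (mv m (ent A) v)"
      by (intro dot_cong) (auto simp: mv_def intro!: sum.cong)
    finally show "0 \<le> dot m v (mv m (ent A) v)" .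
  qed (simp add: quadratic_form_dot[OF True])
  thus ?thesis using True by (auto simp: psd_mats_def psd_def sym_mats_iff)
qed (simp add: psd_mats_def sym_mats_def)

lemma mat_trace_tr: "A \<in> carrier_mat m m \<Longrightarrow> mat_trace A = tr m (ent A)"
  by (simp add: mat_trace_def tr_def ent_def)

lemma lin_mat_carrier: "lin_mat nb m Sk z \<in> carrier_mat m m"
  by (simp add: lin_mat_def mat_sum_def)

lemma ent_lin_mat:
  assumes "\<And>i. i < nb \<Longrightarrow> Sk i \<in> carrier_mat m m" "p < m" "q < m"
  shows "ent (lin_mat nb m Sk z) p q = lin nb (\<lambda>i. ent (Sk i)) (($) z) p q"
proof -
  have "(z $ i \<cdot>\<^sub>m Sk i) $$ (p, q) = z $ i * Sk i $$ (p, q)" if "i < nb" for i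
    using assms(1)[OF that] assms(2,3) by auto
  thus ?thesis using assms(2,3) by (simp add: ent_def lin_mat_def mat_sum_def lin_def)
qed

lemma mv_cong: "(\<And>p q. p < m \<Longrightarrow> q < m \<Longrightarrow> A p q = B p q) \<Longrightarrow> i < m \<Longrightarrow> mv m A v i = mv m B v i"
  by (simp add: mv_def)

text \<open>
For symmetric \<open>M\<close> one has \<open><v, M\<^sup>2 v> = <M v, M v>\<close>; in this form the constraints of the spectratope
enter all estimates.
\<close>

lemma loewner_le_square_iff:
  fixes z :: "real Matrix.vec"
  assumes S: "\<And>i. i < nb \<Longrightarrow> Sk i \<in> sym_mats m"
  defines "M \<equiv> lin nb (\<lambda>i. ent (Sk i)) (($) z)"
  shows "loewner_le m (lin_mat nb m Sk z ^\<^sub>m 2) (c \<cdot>\<^sub>m 1\<^sub>m m)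
     \<longleftrightarrow> (\<forall>v. dot m (mv m M v) (mv m M v) \<le> c * dot m v v)"
proof -
  let ?A = "lin_mat nb m Sk z"
  have A: "?A \<in> carrier_mat m m" by (rule lin_mat_carrier)
  have entA: "ent ?A p q = M p q" if "p < m" "q < m" for p q
    unfolding M_def using S that by (intro ent_lin_mat) (auto simp: sym_mats_iff)
  have symM: "symm m M" unfolding M_def using S by (intro symm_lin) (auto simp: sym_mats_iff)
  have A2: "?A ^\<^sub>m 2 = ?A * ?A" using A by (simp add: numeral_2_eq_2)
  have A2c: "?A ^\<^sub>m 2 \<in> carrier_mat m m" using A by simp
  have ent2: "ent (?A ^\<^sub>m 2) p q = dot m (M p) (M q)" if "p < m" "q < m" for p q
  proof -
    have "ent (?A ^\<^sub>m 2) p q = (\<Sum>r<m. ent ?A p r * ent ?A r q)"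
      using A that by (simp add: A2 ent_def scalar_prod_def atLeast0LessThan)
    also have "\<dots> = dot m (M p) (M q)"
      unfolding dot_def using that entA symM by (intro sum.cong refl) (auto simp: symm_def)
    finally show ?thesis .
  qed
  have one: "ent (c \<cdot>\<^sub>m 1\<^sub>m m) p q = (if p = q then c else 0)" if "p < m" "q < m" for p q
    using that by (simp add: ent_def)
  have sym2: "?A ^\<^sub>m 2 \<in> sym_mats m"
    unfolding sym_mats_iff using A2c ent2 by (auto simp: symm_def dot_commute)
  have symc: "c \<cdot>\<^sub>m 1\<^sub>m m \<in> sym_mats m"
    unfolding sym_mats_iff using one by (auto simp: symm_def)
  have entd: "ent (c \<cdot>\<^sub>m 1\<^sub>m m - ?A ^\<^sub>m 2) p q = (if p = q then c else 0) - dot m (M p) (M q)"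
    if "p < m" "q < m" for p q
  proof -
    have "ent (c \<cdot>\<^sub>m 1\<^sub>m m - ?A ^\<^sub>m 2) p q = ent (c \<cdot>\<^sub>m 1\<^sub>m m) p q - ent (?A ^\<^sub>m 2) p q"
      using that carrier_matD[OF A2c] unfolding ent_def by (intro index_minus_mat) auto
    thus ?thesis by (simp only: one[OF that] ent2[OF that])
  qed
  have form: "dot m v (mv m (ent (c \<cdot>\<^sub>m 1\<^sub>m m - ?A ^\<^sub>m 2)) v)
      = c * dot m v v - dot m (mv m M v) (mv m M v)" for v
  proof -
    have "mv m (ent (c \<cdot>\<^sub>m 1\<^sub>m m - ?A ^\<^sub>m 2)) v p = c * v p - mv m M (mv m M v) p" if p: "p < m" for p
    proof -
      have "mv m (ent (c \<cdot>\<^sub>m 1\<^sub>m m - ?A ^\<^sub>m 2)) v p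
          = (\<Sum>q<m. (if q = p then c * v q else 0) - dot m (M p) (M q) * v q)"
        unfolding mv_def using entd[OF p] by (intro sum.cong refl) (simp add: left_diff_distrib)
      also have "\<dots> = c * v p - (\<Sum>q<m. dot m (M p) (M q) * v q)"
        using p by (simp add: sum_subtractf)
      also have "(\<Sum>q<m. dot m (M p) (M q) * v q) = (\<Sum>q<m. v q * dot m (M p) (M q))"
        by (simp add: mult.commute)
      also have "\<dots> = dot m (M p) (\<lambda>r. \<Sum>q<m. v q * M q r)"
        by (simp only: dot_lin_right)
      also have "\<dots> = dot m (M p) (mv m M v)"
        using symM by (intro dot_cong refl) (auto simp: mv_def symm_def mult.commute intro!: sum.cong)
      finally show ?thesis by (simp add: mv_def[of m M "mv m M v"] dot_def)
    qed
    hence "dot m v (mv m (ent (c \<cdot>\<^sub>m 1\<^sub>m m - ?A ^\<^sub>m 2)) v)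
        = dot m v (\<lambda>p. c * v p - mv m M (mv m M v) p)"
      by (intro dot_cong) auto
    also have "\<dots> = c * dot m v v - dot m v (mv m M (mv m M v))"
      unfolding dot_diff_right dot_scale ..
    finally show ?thesis by (simp only: mv_self_adjoint[OF symM, of v])
  qed
  have "symm m (ent (c \<cdot>\<^sub>m 1\<^sub>m m - ?A ^\<^sub>m 2))"
    unfolding symm_def using entd by (auto simp: dot_commute)
  moreover have "c \<cdot>\<^sub>m 1\<^sub>m m - ?A ^\<^sub>m 2 \<in> carrier_mat m m"
    by (rule minus_carrier_mat[OF A2c])
  ultimately show ?thesis
    unfolding loewner_le_def psd_mats_iff psd_def form using sym2 symc by simp
qed

lemma mat_trace_triple:
  assumes "L \<in> carrier_mat m m" "A \<in> carrier_mat m m" "B \<in> sym_mats m"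
  shows "mat_trace (L * A * B) = (\<Sum>p<m. \<Sum>q<m. ent L p q * dot m (ent A q) (ent B p))"
proof -
  have B: "B \<in> carrier_mat m m" "symm m (ent B)" using assms by (auto simp: sym_mats_iff)
  have "ent (L * A * B) p p = (\<Sum>q<m. ent L p q * dot m (ent A q) (ent B p))" if p: "p < m" for p
  proof -
    have "ent (L * A * B) p p = (\<Sum>q<m. ent L p q * (\<Sum>r<m. ent A q r * ent B r p))"
      using p assms(1,2) B(1) by (simp add: ent_def scalar_prod_def atLeast0LessThan)
    also have "\<dots> = (\<Sum>q<m. ent L p q * dot m (ent A q) (ent B p))"
      using p B(2) by (simp add: dot_def symm_def)
    finally show ?thesis .
  qed
  moreover have "L * A * B \<in> carrier_mat m m" using assms(1,2) B(1) by simp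
  ultimately show ?thesis by (simp add: mat_trace_tr tr_def)
qed

text \<open>
The quadratic form of the adjoint expression at \<open>z\<close> is \<open>Tr (L * S[z] * S[z])\<close>.
\<close>

lemma quad_adj_form:
  assumes "L \<in> carrier_mat m m" and S: "\<And>i. i < nb \<Longrightarrow> Sk i \<in> sym_mats m"
  shows "dot nb z (mv nb (ent (quad_adj nb Sk L)) z) = tr2 m (ent L) (lin nb (\<lambda>i. ent (Sk i)) z)"
proof -
  have "dot nb z (mv nb (ent (quad_adj nb Sk L)) z)
      = (\<Sum>i<nb. \<Sum>j<nb. z i * (ent (quad_adj nb Sk L) i j * z j))"
    by (simp add: dot_def mv_def sum_distrib_left)
  also have "\<dots> = (\<Sum>i<nb. \<Sum>j<nb. \<Sum>p<m. \<Sum>q<m. ent L p q * (z i * (z j * dot m (ent (Sk i) q) (ent (Sk j) p))))"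
  proof (intro sum.cong refl)
    fix i j assume ij: "i \<in> {..<nb}" "j \<in> {..<nb}"
    hence "ent (quad_adj nb Sk L) i j = (\<Sum>p<m. \<Sum>q<m. ent L p q * dot m (ent (Sk i) q) (ent (Sk j) p))"
      using assms(1) S mat_trace_triple[of L m "Sk i" "Sk j"]
      by (auto simp: ent_def quad_adj_def sym_mats_def)
    thus "z i * (ent (quad_adj nb Sk L) i j * z j)
        = (\<Sum>p<m. \<Sum>q<m. ent L p q * (z i * (z j * dot m (ent (Sk i) q) (ent (Sk j) p))))"
      by (simp add: sum_distrib_left sum_distrib_right mult_ac)
  qed
  also have "\<dots> = (\<Sum>i<nb. \<Sum>p<m. \<Sum>j<nb. \<Sum>q<m. ent L p q * (z i * (z j * dot m (ent (Sk i) q) (ent (Sk j) p))))"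
    by (intro sum.cong refl sum.swap)
  also have "\<dots> = (\<Sum>p<m. \<Sum>i<nb. \<Sum>j<nb. \<Sum>q<m. ent L p q * (z i * (z j * dot m (ent (Sk i) q) (ent (Sk j) p))))"
    by (rule sum.swap)
  also have "\<dots> = (\<Sum>p<m. \<Sum>i<nb. \<Sum>q<m. \<Sum>j<nb. ent L p q * (z i * (z j * dot m (ent (Sk i) q) (ent (Sk j) p))))"
    by (intro sum.cong refl sum.swap)
  also have "\<dots> = (\<Sum>p<m. \<Sum>q<m. \<Sum>i<nb. \<Sum>j<nb. ent L p q * (z i * (z j * dot m (ent (Sk i) q) (ent (Sk j) p))))"
    by (intro sum.cong refl sum.swap)
  also have "\<dots> = (\<Sum>p<m. \<Sum>q<m. ent L p q * dot m (\<lambda>r. \<Sum>i<nb. z i * ent (Sk i) q r) (\<lambda>r. \<Sum>j<nb. z j * ent (Sk j) p r))"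
    unfolding dot_lin_left dot_lin_right sum_distrib_left by simp
  also have "\<dots> = tr2 m (ent L) (lin nb (\<lambda>i. ent (Sk i)) z)"
    unfolding tr2_def lin_def by (intro sum.cong refl) (simp add: dot_commute)
  finally show ?thesis .
qed

lemma mat_sum_form:
  fixes A :: "'k::finite \<Rightarrow> real mat"
  shows "dot n z (mv n (ent (mat_sum n UNIV A)) z) = (\<Sum>k\<in>UNIV. dot n z (mv n (ent (A k)) z))"
proof -
  have "mv n (ent (mat_sum n UNIV A)) z i = (\<Sum>k\<in>UNIV. 1 * mv n (ent (A k)) z i)" if "i < n" for i
    unfolding mv_def using that
    by (simp add: ent_def mat_sum_def sum_distrib_right) (rule sum.swap)
  hence "dot n z (mv n (ent (mat_sum n UNIV A)) z) = dot n z (\<lambda>i. \<Sum>k\<in>UNIV. 1 * mv n (ent (A k)) z i)"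
    by (intro dot_cong) auto
  thus ?thesis unfolding dot_lin_right by simp
qed

lemma transpose_congruence_form:
  assumes P: "P \<in> carrier_mat n nb" and X: "X \<in> carrier_mat n n" and x: "x \<in> carrier_vec n"
    and z: "z \<in> carrier_vec nb"
  shows "(P *\<^sub>v z) \<bullet> (X *\<^sub>v (P *\<^sub>v z)) + 2 * (x \<bullet> (P *\<^sub>v z))
       = quad nb (ent (transpose_mat P * X * P)) (($) (transpose_mat P *\<^sub>v x)) (($) z)"
proof -
  have Pt: "transpose_mat P \<in> carrier_mat nb n" using P by simp
  have adj: "z \<bullet> (transpose_mat P *\<^sub>v w) = (P *\<^sub>v z) \<bullet> w" if w: "w \<in> carrier_vec n" for w
    using transpose_vec_mult_scalar[OF P z w] w P z by (metis comm_scalar_prod mult_mat_vec_carrier Pt)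
  have "z \<bullet> ((transpose_mat P * X * P) *\<^sub>v z) = z \<bullet> (transpose_mat P *\<^sub>v (X *\<^sub>v (P *\<^sub>v z)))"
    using P X z Pt by (simp add: assoc_mult_mat_vec[of _ nb n] assoc_mult_mat_vec[of _ nb n _ nb])
  also have "\<dots> = (P *\<^sub>v z) \<bullet> (X *\<^sub>v (P *\<^sub>v z))" using P X z by (intro adj) auto
  finally have "(P *\<^sub>v z) \<bullet> (X *\<^sub>v (P *\<^sub>v z)) = z \<bullet> ((transpose_mat P * X * P) *\<^sub>v z)" by simp
  moreover have "z \<bullet> ((transpose_mat P * X * P) *\<^sub>v z)
      = dot nb (($) z) (mv nb (ent (transpose_mat P * X * P)) (($) z))"
    using P X z by (intro quadratic_form_dot) auto
  moreover have "x \<bullet> (P *\<^sub>v z) = dot nb (($) (transpose_mat P *\<^sub>v x)) (($) z)"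
  proof -
    have "x \<bullet> (P *\<^sub>v z) = (P *\<^sub>v z) \<bullet> x"
      using P z x by (intro comm_scalar_prod[of _ n]) auto
    also have "\<dots> = z \<bullet> (transpose_mat P *\<^sub>v x)" by (rule adj[OF x, symmetric])
    also have "\<dots> = dot nb (($) z) (($) (transpose_mat P *\<^sub>v x))"
      using Pt x by (intro scalar_prod_dot) auto
    finally show ?thesis by (simp only: dot_commute)
  qed
  ultimately show ?thesis by (simp add: quad_def)
qed

lemma symm_ent_congruence:
  assumes P: "P \<in> carrier_mat n nb" and X: "X \<in> sym_mats n"
  shows "symm nb (ent (transpose_mat P * X * P))"
proof -
  have Xc: "X \<in> carrier_mat n n" and Xt: "transpose_mat X = X" using X by (auto simp: sym_mats_def)
  have Pt: "transpose_mat P \<in> carrier_mat nb n" using P by simp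
  have "transpose_mat (transpose_mat P * X * P) = transpose_mat P * (transpose_mat X * P)"
    using transpose_mult[OF mult_carrier_mat[OF Pt Xc] P] transpose_mult[OF Pt Xc] P by simp
  also have "\<dots> = transpose_mat P * X * P" using Xt assoc_mult_mat[OF Pt Xc P] by simp
  finally have "transpose_mat P * X * P \<in> sym_mats nb" using P Xc by (simp add: sym_mats_def)
  thus ?thesis by (simp add: sym_mats_iff)
qed

text \<open>
The block matrix condition is equivalent to the domination of \<open>q\<close> by the form of the multipliers plus
\<open>\<tau>\<close>, so the whole system becomes one about functions.
\<close>

lemma approx_feasible_iff:
  fixes f :: "'k::finite \<Rightarrow> nat" and S :: "'k \<Rightarrow> nat \<Rightarrow> real mat"
  assumes P: "P \<in> carrier_mat n nb" and S: "\<And>k i. i < nb \<Longrightarrow> S k i \<in> sym_mats (f k)"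
    and X: "X \<in> sym_mats n" and x: "x \<in> carrier_vec n"
  defines "q \<equiv> quad nb (ent (transpose_mat P * X * P)) (($) (transpose_mat P *\<^sub>v x))"
  shows "approx_feasible n nb f P S T \<rho> X x \<xi> L \<tau> \<longleftrightarrow>
     (\<forall>k. L k \<in> psd_mats (f k)) \<and>
     (\<forall>z. q z \<le> (\<Sum>k\<in>UNIV. tr2 (f k) (ent (L k)) (lin nb (\<lambda>i. ent (S k i)) z)) + \<tau>) \<and>
     \<rho> * support_fun T (vec_lambda (\<lambda>k. tr (f k) (ent (L k)))) + \<tau> \<le> \<xi>"
proof (cases "\<forall>k. L k \<in> psd_mats (f k)")
  case True
  have Xc: "X \<in> carrier_mat n n" using X by (simp add: sym_mats_def)
  have Lc: "L k \<in> carrier_mat (f k) (f k)" for k using True by (auto simp: psd_mats_iff)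
  let ?A = "mat_sum nb UNIV (\<lambda>k. quad_adj nb (S k) (L k))"
  let ?B = "transpose_mat P * X * P"
  let ?b = "($) (transpose_mat P *\<^sub>v x)"
  let ?M = "four_block_mat (?A - ?B) (- (transpose_mat P * mat_of_cols n [x]))
       (- (mat_of_rows n [x] * P)) (Matrix.mat 1 1 (\<lambda>_. \<tau>))"
  have A: "?A \<in> carrier_mat nb nb" by (simp add: mat_sum_def)
  have B: "?B \<in> carrier_mat nb nb" using P Xc by simp
  have AB: "?A - ?B \<in> carrier_mat nb nb" by (rule minus_carrier_mat[OF B])
  have M: "?M \<in> carrier_mat (nb + 1) (nb + 1)"
    using AB by (intro four_block_carrier_mat) auto
  have symA: "symm nb (ent ?A)"
  proof -
    have "ent (quad_adj nb (S k) (L k)) i j = ent (quad_adj nb (S k) (L k)) j i"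
      if ij: "i < nb" "j < nb" for k i j
    proof -
      have Lsym: "symm (f k) (ent (L k))" using True by (auto simp: psd_mats_iff psd_def)
      have "(\<Sum>p<f k. \<Sum>q<f k. ent (L k) p q * dot (f k) (ent (S k i) q) (ent (S k j) p))
          = (\<Sum>q<f k. \<Sum>p<f k. ent (L k) q p * dot (f k) (ent (S k j) p) (ent (S k i) q))"
        using Lsym by (subst sum.swap) (auto simp: symm_def dot_commute intro!: sum.cong)
      thus ?thesis using ij S[of i k] S[of j k] Lc[of k]
          mat_trace_triple[of "L k" "f k" "S k i" "S k j"] mat_trace_triple[of "L k" "f k" "S k j" "S k i"]
        by (simp add: ent_def quad_adj_def sym_mats_def)
    qed
    thus ?thesis unfolding symm_def by (simp add: ent_def mat_sum_def)
  qed
  have entAB: "ent (?A - ?B) i j = ent ?A i j - ent ?B i j" if "i < nb" "j < nb" for i j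
    using that carrier_matD[OF B] unfolding ent_def by (intro index_minus_mat) auto
  have symAB: "symm nb (ent (?A - ?B))"
    using symA symm_ent_congruence[OF P X] entAB by (simp add: symm_def)
  have "psd (nb + 1) (ent ?M) \<longleftrightarrow> (\<forall>z. 2 * dot nb ?b z - dot nb z (mv nb (ent (?A - ?B)) z) \<le> \<tau>)"
  proof (rule bordered_psd_iff[OF _ _ _ _ symAB])
    show "ent ?M i j = ent (?A - ?B) i j" if "i < nb" "j < nb" for i j
      using that AB carrier_matD[OF AB] by (simp add: ent_def)
    show "ent ?M i nb = - ?b i" if "i < nb" for i
      using that carrier_matD[OF AB] P x by (simp add: ent_def mat_of_cols_def scalar_prod_def)
    show "ent ?M nb j = - ?b j" if "j < nb" for j
      using that carrier_matD[OF AB] P x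
      by (simp add: ent_def mat_of_rows_def scalar_prod_def mult.commute)
    show "ent ?M nb nb = \<tau>"
      using carrier_matD[OF AB] by (simp add: ent_def)
  qed
  moreover have "2 * dot nb ?b z - dot nb z (mv nb (ent (?A - ?B)) z)
      = q z - (\<Sum>k\<in>UNIV. tr2 (f k) (ent (L k)) (lin nb (\<lambda>i. ent (S k i)) z))" for z
  proof -
    have "dot nb z (mv nb (ent (?A - ?B)) z) = dot nb z (mv nb (\<lambda>p q. 1 * ent ?A p q + (-1) * ent ?B p q) z)"
      by (intro dot_cong refl mv_cong) (simp_all add: entAB)
    also have "\<dots> = dot nb z (mv nb (ent ?A) z) - dot nb z (mv nb (ent ?B) z)"
      unfolding dot_mv_mix by simp
    also have "dot nb z (mv nb (ent ?A) z)
        = (\<Sum>k\<in>UNIV. tr2 (f k) (ent (L k)) (lin nb (\<lambda>i. ent (S k i)) z))"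
      unfolding mat_sum_form using S by (intro sum.cong refl quad_adj_form[OF Lc])
    finally show ?thesis by (simp add: q_def quad_def)
  qed
  ultimately have "?M \<in> psd_mats (nb + 1) \<longleftrightarrow>
     (\<forall>z. q z \<le> (\<Sum>k\<in>UNIV. tr2 (f k) (ent (L k)) (lin nb (\<lambda>i. ent (S k i)) z)) + \<tau>)"
    using M by (simp add: psd_mats_iff algebra_simps)
  moreover have "mat_trace (L k) = tr (f k) (ent (L k))" for k by (rule mat_trace_tr[OF Lc])
  ultimately show ?thesis using True by (simp add: approx_feasible_def)
qed (unfold approx_feasible_def, blast)

lemma inner_le_support_fun:
  assumes "compact T" "t \<in> T" shows "inner l t \<le> support_fun T l"
proof -
  have "compact ((\<lambda>t. inner l t) ` T)"
    using assms(1) by (intro compact_continuous_image continuous_intros)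
  hence "bdd_above ((\<lambda>t. inner l t) ` T)" 
    by (intro bounded_imp_bdd_above compact_imp_bounded)
  thus ?thesis unfolding support_fun_def using assms(2) by (rule cSUP_upper2[OF _ _ order_refl])
qed

lemma inner_vec_lambda:
  fixes t :: "real ^ 'k::finite"
  shows "inner (vec_lambda a) t = (\<Sum>k\<in>UNIV. vec_nth t k * a k)"
  by (simp add: inner_vec_def mult.commute)

lemma semi_inf_feasible_spectratope_iff:
  fixes f :: "'k::finite \<Rightarrow> nat" and S :: "'k \<Rightarrow> nat \<Rightarrow> real mat"
  assumes P: "P \<in> carrier_mat n nb" and S: "\<And>k i. i < nb \<Longrightarrow> S k i \<in> sym_mats (f k)"
    and X: "X \<in> sym_mats n" and x: "x \<in> carrier_vec n"
  defines "q \<equiv> quad nb (ent (transpose_mat P * X * P)) (($) (transpose_mat P *\<^sub>v x))"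
  shows "semi_inf_feasible (spectratope nb f P S T s) X x \<xi> \<longleftrightarrow>
    (\<forall>t\<in>T. \<forall>z. (\<forall>k v. dot (f k) (mv (f k) (lin nb (\<lambda>i. ent (S k i)) z) v)
        (mv (f k) (lin nb (\<lambda>i. ent (S k i)) z) v) \<le> s * vec_nth t k * dot (f k) v v) \<longrightarrow> q z \<le> \<xi>)"
proof -
  have Xc: "X \<in> carrier_mat n n" using X by (simp add: sym_mats_def)
  define C where "C t z \<longleftrightarrow> (\<forall>k v. dot (f k) (mv (f k) (lin nb (\<lambda>i. ent (S k i)) z) v)
        (mv (f k) (lin nb (\<lambda>i. ent (S k i)) z) v) \<le> s * vec_nth t k * dot (f k) v v)" for t z
  have "semi_inf_feasible (spectratope nb f P S T s) X x \<xi> \<longleftrightarrow>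
    (\<forall>t\<in>T. \<forall>z\<in>carrier_vec nb. C t (($) z) \<longrightarrow> q (($) z) \<le> \<xi>)"
  proof -
    have "(\<forall>k. loewner_le (f k) (lin_mat nb (f k) (S k) z ^\<^sub>m 2) (s * vec_nth t k \<cdot>\<^sub>m 1\<^sub>m (f k)))
        \<longleftrightarrow> C t (($) z)" for t z
      unfolding C_def using loewner_le_square_iff[OF S] by simp
    hence "semi_inf_feasible (spectratope nb f P S T s) X x \<xi> \<longleftrightarrow>
      (\<forall>t\<in>T. \<forall>z\<in>carrier_vec nb. C t (($) z) \<longrightarrow>
         (P *\<^sub>v z) \<bullet> (X *\<^sub>v (P *\<^sub>v z)) + 2 * (x \<bullet> (P *\<^sub>v z)) \<le> \<xi>)"
      unfolding semi_inf_feasible_def spectratope_def by blast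
    thus ?thesis by (simp add: transpose_congruence_form[OF P Xc x] q_def)
  qed
  also have "\<dots> \<longleftrightarrow> (\<forall>t\<in>T. \<forall>z. C t z \<longrightarrow> q z \<le> \<xi>)"
  proof (intro iffI ballI allI impI)
    fix t z assume h: "\<forall>t\<in>T. \<forall>z\<in>carrier_vec nb. C t (($) z) \<longrightarrow> q (($) z) \<le> \<xi>" "t \<in> T" "C t z"
    have "lin nb (\<lambda>i. ent (S k i)) (($) (Matrix.vec nb z)) = lin nb (\<lambda>i. ent (S k i)) z" for k
      by (simp add: lin_def)
    hence "C t (($) (Matrix.vec nb z))" using h(3) by (simp add: C_def)
    hence "q (($) (Matrix.vec nb z)) \<le> \<xi>" using h(1,2) by simp
    moreover have "q (($) (Matrix.vec nb z)) = q z"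
      unfolding q_def quad_def by (simp add: dot_def mv_def)
    ultimately show "q z \<le> \<xi>" by simp
  qed blast
  finally show ?thesis by (simp only: C_def)
qed

section \<open>The two halves of the theorem\<close>

text \<open>
Weak duality: on the spectratope \<open>Tr (L\<^sub>k S\<^sub>k[z]\<^sup>2) \<le> \<rho> t\<^sub>k Tr L\<^sub>k\<close>, and the sum of the right-hand sides is at
most \<open>\<rho>\<close> times the support function.
\<close>

lemma approximation_is_safe:
  fixes f :: "'k::finite \<Rightarrow> nat" and S :: "'k \<Rightarrow> nat \<Rightarrow> real mat" and T :: "(real ^ 'k) set"
  assumes P: "P \<in> carrier_mat n nb" and S: "\<And>k i. i < nb \<Longrightarrow> S k i \<in> sym_mats (f k)"
    and X: "X \<in> sym_mats n" and x: "x \<in> carrier_vec n"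
    and T: "compact T" and \<rho>: "0 \<le> \<rho>"
    and feasible: "approx_feasible n nb f P S T \<rho> X x \<xi> L \<tau>"
  shows "semi_inf_feasible (spectratope nb f P S T \<rho>) X x \<xi>"
proof -
  define q where "q = quad nb (ent (transpose_mat P * X * P)) (($) (transpose_mat P *\<^sub>v x))"
  let ?lin = "\<lambda>k. lin nb (\<lambda>i. ent (S k i))"
  have feas: "approx_feasible n nb f P S T \<rho> X x \<xi> L \<tau> \<longleftrightarrow>
     (\<forall>k. L k \<in> psd_mats (f k)) \<and>
     (\<forall>z. q z \<le> (\<Sum>k\<in>UNIV. tr2 (f k) (ent (L k)) (?lin k z)) + \<tau>) \<and>
     \<rho> * support_fun T (vec_lambda (\<lambda>k. tr (f k) (ent (L k)))) + \<tau> \<le> \<xi>" for L \<tau>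
    unfolding q_def by (intro approx_feasible_iff P S X x)
  have semi: "semi_inf_feasible (spectratope nb f P S T s) X x \<xi> \<longleftrightarrow>
    (\<forall>t\<in>T. \<forall>z. (\<forall>k v. dot (f k) (mv (f k) (?lin k z) v) (mv (f k) (?lin k z) v)
        \<le> s * vec_nth t k * dot (f k) v v) \<longrightarrow> q z \<le> \<xi>)" for s
    unfolding q_def by (rule semi_inf_feasible_spectratope_iff[OF P _ X x]) (rule S)
  have L: "\<And>k. L k \<in> psd_mats (f k)"
    and q: "\<And>z. q z \<le> (\<Sum>k\<in>UNIV. tr2 (f k) (ent (L k)) (?lin k z)) + \<tau>"
    and \<tau>: "\<rho> * support_fun T (vec_lambda (\<lambda>k. tr (f k) (ent (L k)))) + \<tau> \<le> \<xi>"
    using feasible unfolding feas by blast+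
  show ?thesis unfolding semi
  proof (intro ballI allI impI)
    fix t z
    assume t: "t \<in> T" and z: "\<forall>k v. dot (f k) (mv (f k) (?lin k z) v) (mv (f k) (?lin k z) v)
        \<le> \<rho> * vec_nth t k * dot (f k) v v"
    have "(\<Sum>k\<in>UNIV. tr2 (f k) (ent (L k)) (?lin k z))
        \<le> (\<Sum>k\<in>UNIV. \<rho> * vec_nth t k * tr (f k) (ent (L k)))"
      using L z S by (intro sum_mono tr2_le_trace symm_lin) (auto simp: psd_mats_iff sym_mats_iff)
    also have "\<dots> = \<rho> * inner (vec_lambda (\<lambda>k. tr (f k) (ent (L k)))) t"
      unfolding inner_vec_lambda by (simp add: sum_distrib_left mult.assoc)
    also have "\<dots> \<le> \<rho> * support_fun T (vec_lambda (\<lambda>k. tr (f k) (ent (L k))))"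
      using \<rho> by (intro mult_left_mono inner_le_support_fun[OF T t])
    finally show "q z \<le> \<xi>" using q[of z] \<tau> by linarith
  qed
qed

text \<open>
If a distribution of points satisfying the constraints at level \<open>\<rho>\<close> on average had mean objective
above \<open>\<xi>\<close>, rounding would produce a point of the spectratope at the enlarged level with objective above
\<open>\<xi>\<close>. So the relaxed problem is bounded by \<open>\<xi>\<close>, and its Lagrange multipliers solve the system with
\<open>\<tau> = \<xi> - \<rho> \<phi>\<close>.
\<close>

lemma approximation_is_tight:
  fixes f :: "'k::finite \<Rightarrow> nat" and S :: "'k \<Rightarrow> nat \<Rightarrow> real mat" and T :: "(real ^ 'k) set"
  assumes P: "P \<in> carrier_mat n nb" and S: "\<And>k i. i < nb \<Longrightarrow> S k i \<in> sym_mats (f k)"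
    and X: "X \<in> sym_mats n" and x: "x \<in> carrier_vec n"
    and f: "\<And>k. f k \<ge> 1" and T: "T \<noteq> {}" "convex T" "T \<subseteq> {t. 0 \<le> t}"
    and slater: "T \<inter> interior {t. 0 \<le> t} \<noteq> {}" and \<rho>: "0 < \<rho>"
    and feasible: "semi_inf_feasible (spectratope nb f P S T (2 * ln (8 * (\<Sum>k\<in>UNIV. real (f k))) * \<rho>)) X x \<xi>"
  shows "\<exists>L \<tau>. approx_feasible n nb f P S T \<rho> X x \<xi> L \<tau>"
proof -
  define q where "q = quad nb (ent (transpose_mat P * X * P)) (($) (transpose_mat P *\<^sub>v x))"
  let ?lin = "\<lambda>k. lin nb (\<lambda>i. ent (S k i))"
  have feas: "approx_feasible n nb f P S T \<rho> X x \<xi> L \<tau> \<longleftrightarrow>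
     (\<forall>k. L k \<in> psd_mats (f k)) \<and>
     (\<forall>z. q z \<le> (\<Sum>k\<in>UNIV. tr2 (f k) (ent (L k)) (?lin k z)) + \<tau>) \<and>
     \<rho> * support_fun T (vec_lambda (\<lambda>k. tr (f k) (ent (L k)))) + \<tau> \<le> \<xi>" for L \<tau>
    unfolding q_def by (intro approx_feasible_iff P S X x)
  have semi: "semi_inf_feasible (spectratope nb f P S T s) X x \<xi> \<longleftrightarrow>
    (\<forall>t\<in>T. \<forall>z. (\<forall>k v. dot (f k) (mv (f k) (?lin k z) v) (mv (f k) (?lin k z) v)
        \<le> s * vec_nth t k * dot (f k) v v) \<longrightarrow> q z \<le> \<xi>)" for s
    unfolding q_def by (rule semi_inf_feasible_spectratope_iff[OF P _ X x]) (rule S)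
  let ?\<kappa> = "2 * ln (8 * (\<Sum>k\<in>UNIV. real (f k)))"
  have symS: "symm (f k) (ent (S k i))" if "i < nb" for k i
    using S[OF that] by (simp add: sym_mats_iff)
  have robust: "q z \<le> \<xi>" if "t \<in> T" and "\<And>k v. dot (f k) (mv (f k) (?lin k z) v)
      (mv (f k) (?lin k z) v) \<le> ?\<kappa> * \<rho> * vec_nth t k * dot (f k) v v" for t z
    using feasible that unfolding semi by blast
  obtain tb where tb: "tb \<in> T" "tb \<in> interior {t. 0 \<le> t}" using slater by blast
  have tbpos: "0 < vec_nth tb k" for k
  proof -
    obtain e where e: "0 < e" "ball tb e \<subseteq> {t. 0 \<le> t}" using tb(2) mem_interior by blast
    \<comment> \<open>An interior point can be moved against a coordinate direction, so its coordinates are positive.\<close>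
    have "tb - (e / 2) *\<^sub>R axis k 1 \<in> ball tb e" using e(1) by (simp add: dist_norm)
    hence "0 \<le> tb - (e / 2) *\<^sub>R axis k 1" using e(2) by blast
    hence "vec_nth 0 k \<le> vec_nth (tb - (e / 2) *\<^sub>R axis k 1) k" unfolding Finite_Cartesian_Product.less_eq_vec_def by blast
    thus ?thesis using e(1) by (simp add: axis_def)
  qed
  have bound: "(\<Sum>j<N. p j * q (z j)) \<le> \<xi>"
    if p: "\<And>j. j < N \<Longrightarrow> 0 \<le> p j" "(\<Sum>j<N. p j) \<le> 1" and t: "t \<in> T"
      and var: "\<And>k v. (\<Sum>j<(N::nat). p j * dot (f k) (mv (f k) (?lin k (z j)) v)
           (mv (f k) (?lin k (z j)) v)) \<le> \<rho> * vec_nth t k * dot (f k) v v"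
    for N p z t
  proof (rule ccontr)
    assume "\<not> ?thesis"
    hence obj: "\<xi> < (\<Sum>j<N. p j * q (z j))" by simp
    have "vec_nth 0 k \<le> vec_nth t k" for k using T(3) t unfolding Finite_Cartesian_Product.less_eq_vec_def by blast
    hence \<sigma>: "0 \<le> \<rho> * vec_nth t k" for k using \<rho> by simp
    obtain y where y: "\<xi> < q y" "\<And>k v. dot (f k) (mv (f k) (?lin k y) v)
        (mv (f k) (?lin k y) v) \<le> ?\<kappa> * (\<rho> * vec_nth t k) * dot (f k) v v"
    proof (rule randomized_rounding[where B = "ent (transpose_mat P * X * P)" and f = f and nb = nb
          and S = "\<lambda>k i. ent (S k i)" and \<sigma> = "\<lambda>k. \<rho> * vec_nth t k" and N = N and p = p and z = z
          and \<xi> = \<xi> and b = "($) (transpose_mat P *\<^sub>v x)"])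
      show "symm nb (ent (transpose_mat P * X * P))" by (rule symm_ent_congruence[OF P X])
    qed (use symS f \<sigma> p var obj in \<open>auto simp: q_def\<close>)
    show False using robust[OF t, of y] y by (simp add: mult.assoc)
  qed
  obtain L where L: "\<And>k. psd (f k) (L k)"
    and Lq: "\<And>z t. t \<in> T \<Longrightarrow> q z + \<rho> * (\<Sum>k\<in>UNIV. vec_nth t k * tr (f k) (L k))
         \<le> \<xi> + (\<Sum>k\<in>UNIV. tr2 (f k) (L k) (?lin k z))"
  proof (rule lagrange_multipliers_exist[where f = f and S = "\<lambda>k i. ent (S k i)" and nb = nb and q = q
        and T = T and tb = tb and \<rho> = \<rho> and \<xi> = \<xi>])
    show "(\<Sum>j<N. p j * q (z j)) \<le> \<xi>"
      if "\<And>j. j < N \<Longrightarrow> 0 \<le> p j" "(\<Sum>j<N. p j) \<le> 1" "t \<in> T"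
        "\<And>k v. (\<Sum>j<(N::nat). p j * dot (f k) (mv (f k) (?lin k (z j)) v)
           (mv (f k) (?lin k (z j)) v)) \<le> \<rho> * vec_nth t k * dot (f k) v v"
      for N p z t
      using that by (rule bound)
  qed (use symS T tb tbpos \<rho> in auto)
  define LM where "LM k = Matrix.mat (f k) (f k) (\<lambda>(i, j). L k i j)" for k
  have entL: "ent (LM k) i j = L k i j" if "i < f k" "j < f k" for k i j
    using that by (simp add: LM_def ent_def)
  have psdL: "LM k \<in> psd_mats (f k)" for k
  proof -
    have "dot (f k) v (mv (f k) (ent (LM k)) v) = dot (f k) v (mv (f k) (L k) v)" for v
      by (intro dot_cong refl mv_cong entL)
    hence "psd (f k) (ent (LM k))" using L[of k] entL by (simp add: psd_def symm_def)
    thus ?thesis by (simp add: psd_mats_iff) (simp add: LM_def)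
  qed
  have trL: "tr (f k) (ent (LM k)) = tr (f k) (L k)" for k
    by (simp add: tr_def entL)
  have tr2L: "tr2 (f k) (ent (LM k)) M = tr2 (f k) (L k) M" for k M
    by (rule tr2_cong) (rule entL)
  let ?\<phi> = "support_fun T (vec_lambda (\<lambda>k. tr (f k) (L k)))"
  have "approx_feasible n nb f P S T \<rho> X x \<xi> LM (\<xi> - \<rho> * ?\<phi>)"
    unfolding feas trL tr2L
  proof (intro conjI allI psdL)
    fix z
    let ?R = "\<Sum>k\<in>UNIV. tr2 (f k) (L k) (?lin k z)"
    have "?\<phi> \<le> (\<xi> + ?R - q z) / \<rho>"
      unfolding support_fun_def
    proof (rule cSUP_least[OF T(1)])
      fix t assume "t \<in> T"
      from Lq[OF this, of z] show "inner (vec_lambda (\<lambda>k. tr (f k) (L k))) t \<le> (\<xi> + ?R - q z) / \<rho>"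
        using \<rho> unfolding inner_vec_lambda by (simp add: pos_le_divide_eq mult.commute)
    qed
    hence "\<rho> * ?\<phi> \<le> \<xi> + ?R - q z" using \<rho> by (simp add: pos_le_divide_eq mult.commute)
    thus "q z \<le> ?R + (\<xi> - \<rho> * ?\<phi>)" by simp
  qed simp
  thus ?thesis by blast
qed

theorem theorem3:
  fixes n nb :: nat
    and f :: "'k::finite \<Rightarrow> nat"
    and P :: "real mat"
    and S :: "'k \<Rightarrow> nat \<Rightarrow> real mat"
    and T :: "(real ^ 'k) set"
    and \<rho> :: real
  assumes "n \<ge> 1" and "nb \<ge> 1" and "\<And>k. f k \<ge> 1"
    and "P \<in> carrier_mat n nb"
    and "\<And>k i. i < nb \<Longrightarrow> S k i \<in> sym_mats (f k)"
    and "T \<noteq> {}" and "convex T" and "compact T"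
    and "T \<subseteq> {t. 0 \<le> t}"
    and "T \<inter> interior {t. 0 \<le> t} \<noteq> {}"
    and "\<And>t t'. 0 \<le> t \<Longrightarrow> t \<le> t' \<Longrightarrow> t' \<in> T \<Longrightarrow> t \<in> T"
    and "\<rho> > 0"
  shows "(\<forall>X \<in> sym_mats n. \<forall>x \<in> carrier_vec n. \<forall>\<xi>::real.
            (\<exists>L \<tau>. approx_feasible n nb f P S T \<rho> X x \<xi> L \<tau>) \<longrightarrow>
            semi_inf_feasible (spectratope nb f P S T \<rho>) X x \<xi>) \<and>
         (\<forall>X \<in> sym_mats n. \<forall>x \<in> carrier_vec n. \<forall>\<xi>::real.
            \<not> (\<exists>L \<tau>. approx_feasible n nb f P S T \<rho> X x \<xi> L \<tau>) \<longrightarrow>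
            \<not> semi_inf_feasible
                (spectratope nb f P S T (2 * ln (8 * (\<Sum>k\<in>UNIV. real (f k))) * \<rho>)) X x \<xi>)"
proof (intro conjI ballI allI impI notI)
  fix X :: "real mat" and x :: "real Matrix.vec" and \<xi> :: real
  assume X: "X \<in> sym_mats n" and x: "x \<in> carrier_vec n"
  {
    assume "\<exists>L \<tau>. approx_feasible n nb f P S T \<rho> X x \<xi> L \<tau>"
    then obtain L \<tau> where "approx_feasible n nb f P S T \<rho> X x \<xi> L \<tau>" by blast
    thus "semi_inf_feasible (spectratope nb f P S T \<rho>) X x \<xi>"
      using assms(5,12) by (intro approximation_is_safe[OF assms(4) _ X x assms(8)]) auto
  }
  {
    assume none: "\<not> (\<exists>L \<tau>. approx_feasible n nb f P S T \<rho> X x \<xi> L \<tau>)"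
      and robust: "semi_inf_feasible
        (spectratope nb f P S T (2 * ln (8 * (\<Sum>k\<in>UNIV. real (f k))) * \<rho>)) X x \<xi>"
    have "\<exists>L \<tau>. approx_feasible n nb f P S T \<rho> X x \<xi> L \<tau>"
      by (rule approximation_is_tight[OF assms(4) _ X x _ assms(6,7,9,10,12) robust])
        (rule assms(5) assms(3); assumption?)+
    thus False using none by blast
  }
qed

end
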